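(* Let $(U_n)_{n\in\omega}$ be a Fraïssé sequence in the category $\mathcal F$ of rational projection-embedding pairs (with bonding embeddings regarded as inclusions), and let $\mathbb P$ be the Banach space which is the completion of $\bigcup_{n\in\omega}U_n$. Let $X$ be a Banach space with a monotone finite-dimensional decomposition. Then there exists a linear isometric embedding $e\colon X\to\mathbb P$ such that $e[X]$ is $1$-complemented in $\mathbb P$.
   Context: All Banach spaces are real. An operator is $1$-bounded if it is linear of norm at most $1$. A subspace $Y$ of a Banach space $X$ is $1$-complemented in $X$ if there is a projection $P\colon X\to Y$ (so $Py=y$ for $y\in Y$) with $\|P\|\le 1$. Monotone FDD: a finite-dimensional decomposition (FDD, also called Schauder decomposition) of a Banach space $X$ is a sequence of finite-rank, pairwise orthogonal bounded linear operators $P_n\colon X\to X$ such that $x=\sum_{n=0}^\infty P_nx$ for every $x\in X$. It is monotone if the projections $Q_n=P_0+\dots+P_{n-1}$ satisfy $\sup_n\|Q_n\|\le 1$. Equivalently, there are finite-rank projections $Q_n$ of norm $\le 1$ converging pointwise to the identity with $Q_nQ_m=Q_{\min(n,m)}$ for all $n,m$. The category $\mathcal F$: a Banach space is rational if it is $\mathbb R^n$ (for some $n\ge 0$) with a norm whose unit ball is the convex hull of finitely many vectors with all coordinates rational. A linear operator $T\colon\mathbb R^n\to\mathbb R^m$ is rational if $T[\mathbb Q^n]\subseteq\mathbb Q^m$. The objects of $\mathcal F$ are the rational Banach spaces; an $\mathcal F$-arrow from $E$ to $F$ is a pair $\langle e,P\rangle$ of rational $1$-bounded operators $e\colon E\to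 F$, $P\colon F\to E$ such that $e$ is an isometric embedding and $P\circ e=\mathrm{id}_E$. Composition: $\langle e',P'\rangle\circ\langle e,P\rangle=\langle e'\circ e,\,P\circ P'\rangle$. A sequence in $\mathcal F$ is a covariant functor from $(\omega,\le)$ to $\mathcal F$, i.e. objects $U_n$ with compatible bonding arrows $U_n\to U_m$ for $n\le m$. It is Fraïssé if: for every $n\in\omega$ and every $\mathcal F$-arrow $f\colon U_n\to Y$ there exist $m>n$ and an $\mathcal F$-arrow $g\colon Y\to U_m$ such that $g\circ f$ is the bonding arrow from $U_n$ to $U_m$. Such sequences exist. Identifying the bonding embeddings with inclusions, $(U_n)$ becomes an increasing chain of normed spaces, whose union is a normed space; $\mathbb P$ is its completion (the colimit of the chain in Banach spaces and isometric embeddings). *)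

theory Defs
  imports "HOL-Analysis.Analysis" "HOL-Analysis.Finite_Function_Topology"
begin

definition finite_rank :: "('a::real_vector \<Rightarrow> 'b::real_vector) \<Rightarrow> bool" where
  "finite_rank T \<longleftrightarrow> (\<exists>B. finite B \<and> range T \<subseteq> span B)"

text \<open>That the \<open>P n\<close> are projections follows by applying \<open>P m\<close> to the expansion of \<open>x\<close>.\<close>

definition is_FDD :: "(nat \<Rightarrow> 'a::real_normed_vector \<Rightarrow> 'a) \<Rightarrow> bool" where
  "is_FDD P \<longleftrightarrow>
     (\<forall>n. bounded_linear (P n) \<and> finite_rank (P n)) \<and>
     (\<forall>m n. m \<noteq> n \<longrightarrow> (\<forall>x. P m (P n x) = 0)) \<and>
     (\<forall>x. (\<lambda>n. P n x) sums x)"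

definition monotone_FDD :: "(nat \<Rightarrow> 'a::real_normed_vector \<Rightarrow> 'a) \<Rightarrow> bool" where
  "monotone_FDD P \<longleftrightarrow> is_FDD P \<and> (\<forall>n. onorm (\<lambda>x. \<Sum>i<n. P i x) \<le> 1)"

definition one_complemented :: "'a::real_normed_vector set \<Rightarrow> bool" where
  "one_complemented Y \<longleftrightarrow>
     subspace Y \<and>
     (\<exists>P. bounded_linear P \<and> onorm P \<le> 1 \<and> range P \<subseteq> Y \<and> (\<forall>y\<in>Y. P y = y))"

text \<open>
  The spaces \<open>\<real>\<^sup>n\<close>, for varying \<open>n\<close>, all live inside the real vector space
  \<open>nat \<Rightarrow>\<^sub>0 real\<close> of finitely supported sequences: \<open>\<real>\<^sup>n\<close> consists of the sequences
  supported in \<open>{..<n}\<close>. The norm that the library puts on \<open>nat \<Rightarrow>\<^sub>0 real\<close> plays no role.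
\<close>

type_synonym seq_vec = "nat \<Rightarrow>\<^sub>0 real"

definition coord_space :: "nat \<Rightarrow> seq_vec set" where
  "coord_space n = {x. \<forall>i\<ge>n. Poly_Mapping.lookup x i = 0}"

definition rat_points :: "nat \<Rightarrow> seq_vec set" where
  "rat_points n = {x \<in> coord_space n. \<forall>i. Poly_Mapping.lookup x i \<in> \<rat>}"

text \<open>
  A map on \<open>\<real>\<^sup>n\<close> is represented by a function on \<open>nat \<Rightarrow>\<^sub>0 real\<close> whose values outside
  \<open>coord_space n\<close> are irrelevant; hence linearity, norms and equality of maps are
  all relativised to the carrier.
\<close>

definition linear_map_on :: "'a::real_vector set \<Rightarrow> ('a \<Rightarrow> 'b::real_vector) \<Rightarrow> bool" where
  "linear_map_on V T \<longleftrightarrow>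
     (\<forall>x\<in>V. \<forall>y\<in>V. T (x + y) = T x + T y) \<and>
     (\<forall>c. \<forall>x\<in>V. T (c *\<^sub>R x) = c *\<^sub>R T x)"

definition norm_on :: "'a::real_vector set \<Rightarrow> ('a \<Rightarrow> real) \<Rightarrow> bool" where
  "norm_on V p \<longleftrightarrow>
     (\<forall>x\<in>V. 0 \<le> p x) \<and>
     (\<forall>x\<in>V. p x = 0 \<longleftrightarrow> x = 0) \<and>
     (\<forall>c. \<forall>x\<in>V. p (c *\<^sub>R x) = \<bar>c\<bar> * p x) \<and>
     (\<forall>x\<in>V. \<forall>y\<in>V. p (x + y) \<le> p x + p y)"

record fin_space =
  sp_dim :: nat
  sp_norm :: "seq_vec \<Rightarrow> real"

definition carr :: "fin_space \<Rightarrow> seq_vec set" where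
  "carr E = coord_space (sp_dim E)"

definition rational_space :: "fin_space \<Rightarrow> bool" where
  "rational_space E \<longleftrightarrow>
     norm_on (carr E) (sp_norm E) \<and>
     (\<exists>V. finite V \<and> V \<subseteq> rat_points (sp_dim E) \<and>
          {x \<in> carr E. sp_norm E x \<le> 1} = convex hull V)"

definition rational_1_bounded :: "fin_space \<Rightarrow> fin_space \<Rightarrow> (seq_vec \<Rightarrow> seq_vec) \<Rightarrow> bool" where
  "rational_1_bounded E F T \<longleftrightarrow>
     T ` carr E \<subseteq> carr F \<and>
     linear_map_on (carr E) T \<and>
     T ` rat_points (sp_dim E) \<subseteq> rat_points (sp_dim F) \<and>
     (\<forall>x\<in>carr E. sp_norm F (T x) \<le> sp_norm E x)"

type_synonym arrow = "(seq_vec \<Rightarrow> seq_vec) \<times> (seq_vec \<Rightarrow> seq_vec)"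

definition is_arrow :: "fin_space \<Rightarrow> fin_space \<Rightarrow> arrow \<Rightarrow> bool" where
  "is_arrow E F f \<longleftrightarrow>
     rational_1_bounded E F (fst f) \<and>
     rational_1_bounded F E (snd f) \<and>
     (\<forall>x\<in>carr E. sp_norm F (fst f x) = sp_norm E x) \<and>
     (\<forall>x\<in>carr E. snd f (fst f x) = x)"

definition arrow_eq :: "fin_space \<Rightarrow> fin_space \<Rightarrow> arrow \<Rightarrow> arrow \<Rightarrow> bool" where
  "arrow_eq E F f g \<longleftrightarrow>
     (\<forall>x\<in>carr E. fst f x = fst g x) \<and> (\<forall>y\<in>carr F. snd f y = snd g y)"

definition arrow_id :: arrow where
  "arrow_id = (id, id)"

definition arrow_comp :: "arrow \<Rightarrow> arrow \<Rightarrow> arrow" where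
  "arrow_comp g f = (fst g \<circ> fst f, snd f \<circ> snd g)"

text \<open>\<open>b n m\<close>, for \<open>n \<le> m\<close>, is the bonding arrow from \<open>U n\<close> to \<open>U m\<close>.\<close>

definition is_sequence :: "(nat \<Rightarrow> fin_space) \<Rightarrow> (nat \<Rightarrow> nat \<Rightarrow> arrow) \<Rightarrow> bool" where
  "is_sequence U b \<longleftrightarrow>
     (\<forall>n. rational_space (U n)) \<and>
     (\<forall>n m. n \<le> m \<longrightarrow> is_arrow (U n) (U m) (b n m)) \<and>
     (\<forall>n. arrow_eq (U n) (U n) (b n n) arrow_id) \<and>
     (\<forall>n m k. n \<le> m \<longrightarrow> m \<le> k \<longrightarrow>
        arrow_eq (U n) (U k) (arrow_comp (b m k) (b n m)) (b n k))"

definition Fraisse_sequence :: "(nat \<Rightarrow> fin_space) \<Rightarrow> (nat \<Rightarrow> nat \<Rightarrow> arrow) \<Rightarrow> bool" where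
  "Fraisse_sequence U b \<longleftrightarrow>
     is_sequence U b \<and>
     (\<forall>n Y f. rational_space Y \<and> is_arrow (U n) Y f \<longrightarrow>
        (\<exists>m>n. \<exists>g. is_arrow Y (U m) g \<and> arrow_eq (U n) (U m) (arrow_comp g f) (b n m)))"

text \<open>
  The Banach space \<open>'p\<close> is the completion of the union of the chain \<open>U n\<close> (its colimit in
  Banach spaces and isometric embeddings) when the \<open>U n\<close> embed into it by linear isometries
  \<open>j n\<close>, compatibly with the bonding embeddings, so that the union of the images is dense.
  This determines \<open>'p\<close> and \<open>j\<close> up to a linear isometry.
\<close>

definition is_completion_of_union ::
    "(nat \<Rightarrow> fin_space) \<Rightarrow> (nat \<Rightarrow> nat \<Rightarrow> arrow) \<Rightarrow> (nat \<Rightarrow> seq_vec \<Rightarrow> 'p::banach) \<Rightarrow> bool" where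
  "is_completion_of_union U b j \<longleftrightarrow>
     (\<forall>n. linear_map_on (carr (U n)) (j n)) \<and>
     (\<forall>n. \<forall>x\<in>carr (U n). norm (j n x) = sp_norm (U n) x) \<and>
     (\<forall>n m. n \<le> m \<longrightarrow> (\<forall>x\<in>carr (U n). j m (fst (b n m) x) = j n x)) \<and>
     closure (\<Union>n. j n ` carr (U n)) = UNIV"

end

theory Submission
  imports Defs
begin

text \<open>
  Write \<open>Q n\<close> for the partial sum projections of the decomposition. One builds linear maps
  \<open>A n\<close> from \<open>X\<close> into \<open>U (k n)\<close>, factoring through \<open>Q n\<close> and of norm at most \<open>1 + \<delta> n\<close>,
  and contractions \<open>p n\<close> from \<open>U (k n)\<close> to the range of \<open>Q n\<close> with \<open>p n \<circ> A n = Q n\<close>,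
  such that \<open>p (n + 1)\<close> extends \<open>p n\<close> exactly and \<open>A (n + 1)\<close> extends \<open>A n\<close> up to \<open>2 \<delta> n\<close>.
  Then \<open>e = lim A n\<close> exists, the \<open>p n\<close> glue to a contraction \<open>R\<close> on the completion with
  \<open>R \<circ> e = id\<close>, so \<open>e\<close> is isometric and \<open>e \<circ> R\<close> is a projection of norm at most 1.

  For the inductive step, \<open>U (k n)\<close> and the range of \<open>Q (n + 1)\<close> are amalgamated into one
  finite-dimensional space, almost gluing the range of \<open>Q n\<close> to its image under \<open>A n\<close>. In
  coordinates where the projection onto \<open>U (k n)\<close> is truncation, the only thing left to
  make rational is the norm, and the Fraisse property takes the result back into the chain.
\<close>

subsection \<open>Coordinate spaces and rational approximation of norms\<close>

lemma lookup_scaleR [simp]: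
  "Poly_Mapping.lookup (c *\<^sub>R x) i = c *\<^sub>R Poly_Mapping.lookup x i"
proof -
  have "{i. c *\<^sub>R Poly_Mapping.lookup x i \<noteq> 0} \<subseteq> {i. Poly_Mapping.lookup x i \<noteq> 0}"
    by auto
  then have "finite {i. c *\<^sub>R Poly_Mapping.lookup x i \<noteq> 0}"
    by (rule finite_subset) simp
  then show ?thesis
    by (simp add: scaleR_poly_mapping_def)
qed

lemma subspace_coord_space: "subspace (coord_space n)"
  by (auto simp: subspace_def coord_space_def lookup_add)

lemma coord_space_mono: "m \<le> n \<Longrightarrow> coord_space m \<subseteq> coord_space n"
  by (auto simp: coord_space_def)

lemma coord_space_expand:
  assumes "x \<in> coord_space n"
  shows "x = (\<Sum>i<n. Poly_Mapping.lookup x i *\<^sub>R Poly_Mapping.single i 1)"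
proof (rule poly_mapping_eqI)
  fix k
  have "Poly_Mapping.lookup (\<Sum>i<n. Poly_Mapping.lookup x i *\<^sub>R Poly_Mapping.single i (1::real)) k
      = (\<Sum>i<n. if i = k then Poly_Mapping.lookup x k else 0)"
    unfolding lookup_sum by (intro sum.cong) (auto simp: lookup_single when_def)
  then show "Poly_Mapping.lookup x k
      = Poly_Mapping.lookup (\<Sum>i<n. Poly_Mapping.lookup x i *\<^sub>R Poly_Mapping.single i 1) k"
    using assms by (auto simp: coord_space_def)
qed

text \<open>The library norm is the l1 norm. It serves below as an auxiliary reference norm,
  convenient because its unit ball in \<open>coord_space n\<close> is a polytope with rational
  vertices.\<close>

lemma norm_coord_space:
  assumes "x \<in> coord_space n"
  shows "norm x = (\<Sum>i<n. \<bar>Poly_Mapping.lookup x i\<bar>)"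
proof -
  have "Poly_Mapping.keys x \<subseteq> {..<n}"
    using assms by (auto simp: coord_space_def in_keys_iff) (meson not_le)
  then show ?thesis
    by (simp add: norm_poly_mapping_def dist_poly_mapping_def)
      (rule sum.mono_neutral_left, auto simp: in_keys_iff)
qed

lemma abs_lookup_le_norm: "\<bar>Poly_Mapping.lookup x i\<bar> \<le> norm (x :: seq_vec)"
proof (cases "i \<in> Poly_Mapping.keys x")
  case True
  then show ?thesis
    by (simp add: norm_poly_mapping_def dist_poly_mapping_def)
      (rule member_le_sum, auto)
qed (simp add: in_keys_iff)

lemma closed_coord_space: "closed (coord_space n)"
proof -
  have "bounded_linear (\<lambda>x :: seq_vec. Poly_Mapping.lookup x i)" for i
    by (rule bounded_linear_intro[where K = 1])
      (simp_all add: lookup_add abs_lookup_le_norm)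
  then have "closed {x :: seq_vec. Poly_Mapping.lookup x i = 0}" for i
    by (intro closed_Collect_eq) (auto intro: linear_continuous_on)
  moreover have "coord_space n = (\<Inter>i\<in>{n..}. {x. Poly_Mapping.lookup x i = 0})"
    by (auto simp: coord_space_def)
  ultimately show ?thesis
    by auto
qed

text \<open>The vertices of the cross-polytope, the unit ball of the l1 norm. The point 0 is added
  to carry the leftover weight of convex combinations; it also covers n = 0, where there are no unit
  vectors.\<close>

definition cross_vertices :: "nat \<Rightarrow> seq_vec set" where
  "cross_vertices n = insert 0 (\<Union>i<n. {Poly_Mapping.single i 1, Poly_Mapping.single i (-1)})"

lemma finite_cross_vertices: "finite (cross_vertices n)"
  by (simp add: cross_vertices_def)

lemma lookup_cross_vertices: "s \<in> cross_vertices n \<Longrightarrow> Poly_Mapping.lookup s i \<in> {-1, 0, 1}"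
  by (auto simp: cross_vertices_def lookup_single when_def)

lemma cross_vertices_subset: "cross_vertices n \<subseteq> coord_space n"
  by (auto simp: cross_vertices_def coord_space_def lookup_single when_def)

lemma norm_cross_vertices: "s \<in> cross_vertices n \<Longrightarrow> norm s \<le> 1"
  by (auto simp: cross_vertices_def norm_poly_mapping_def dist_poly_mapping_def)

lemma unit_ball_subset_cross_hull:
  assumes x: "x \<in> coord_space n" and n1: "norm x \<le> 1"
  shows "x \<in> convex hull (cross_vertices n)"
proof -
  \<comment> \<open>The weights are the absolute values of the coordinates, each placed on a signed
    unit vector; index n puts the slack \<open>1 - norm x\<close> on the point 0.\<close>
  define a where "a i = (if i < n then \<bar>Poly_Mapping.lookup x i\<bar> else 1 - norm x)" for i
  define y where "y i = (if i < n then Poly_Mapping.single i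
      (if Poly_Mapping.lookup x i \<ge> 0 then 1 else -1) else (0::seq_vec))" for i
  have "(\<Sum>i\<le>n. a i *\<^sub>R y i) \<in> convex hull (cross_vertices n)"
  proof (rule convex_sum)
    show "sum a {..n} = 1"
      using norm_coord_space[OF x] by (simp add: a_def lessThan_Suc_atMost[symmetric])
    show "0 \<le> a i" for i
      using n1 by (simp add: a_def)
    show "y i \<in> convex hull (cross_vertices n)" for i
      by (rule hull_inc) (auto simp: y_def cross_vertices_def)
  qed auto
  also have "(\<Sum>i\<le>n. a i *\<^sub>R y i) = (\<Sum>i<n. Poly_Mapping.lookup x i *\<^sub>R Poly_Mapping.single i 1)"
  proof -
    have "a i *\<^sub>R y i = Poly_Mapping.lookup x i *\<^sub>R Poly_Mapping.single i 1" if "i < n" for i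
      using that by (intro poly_mapping_eqI) (auto simp: a_def y_def lookup_single when_def)
    then show ?thesis
      by (simp add: lessThan_Suc_atMost[symmetric]) (simp add: y_def)
  qed
  finally show ?thesis
    using coord_space_expand[OF x] by simp
qed

section \<open>Comparison of an arbitrary norm with the l1 norm\<close>

lemma norm_onD:
  assumes "norm_on V p"
  shows norm_on_nonneg: "x \<in> V \<Longrightarrow> 0 \<le> p x"
    and norm_on_eq_0: "x \<in> V \<Longrightarrow> p x = 0 \<longleftrightarrow> x = 0"
    and norm_on_scaleR: "x \<in> V \<Longrightarrow> p (c *\<^sub>R x) = \<bar>c\<bar> * p x"
    and norm_on_triangle: "x \<in> V \<Longrightarrow> y \<in> V \<Longrightarrow> p (x + y) \<le> p x + p y"
  using assms by (auto simp: norm_on_def)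

lemma norm_on_minus: "norm_on V p \<Longrightarrow> x \<in> V \<Longrightarrow> p (- x) = p x"
  using norm_on_scaleR[of V p x "-1"] by simp

lemma norm_on_zero: "norm_on V p \<Longrightarrow> subspace V \<Longrightarrow> p 0 = 0"
  using norm_on_eq_0 subspace_0 by blast

lemma norm_on_le_norm:
  assumes p: "norm_on (coord_space n) p"
  obtains K where "K > 0" "\<And>x. x \<in> coord_space n \<Longrightarrow> p x \<le> K * norm x"
proof
  let ?b = "\<lambda>i. Poly_Mapping.single i (1::real)"
  have b: "?b i \<in> coord_space n" if "i < n" for i
    using that by (auto simp: coord_space_def lookup_single when_def)
  \<comment> \<open>The summand 1 keeps \<open>K\<close> positive even when n = 0.\<close>
  define K where "K = 1 + (\<Sum>i<n. p (?b i))"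
  have pb: "0 \<le> p (?b i)" if "i < n" for i
    using norm_on_nonneg[OF p b[OF that]] .
  show "K > 0"
    using sum_nonneg[of "{..<n}" "\<lambda>i. p (?b i)"] pb by (simp add: K_def)
  show "p x \<le> K * norm x" if x: "x \<in> coord_space n" for x
  proof -
    let ?s = "\<lambda>m. \<Sum>i<m. Poly_Mapping.lookup x i *\<^sub>R ?b i"
    have "?s m \<in> coord_space n \<and> p (?s m) \<le> (\<Sum>i<m. \<bar>Poly_Mapping.lookup x i\<bar> * p (?b i))"
      if "m \<le> n" for m
      using that
    proof (induction m)
      case 0
      then show ?case
        using norm_on_zero[OF p subspace_coord_space] subspace_0[OF subspace_coord_space] by simp
    next
      case (Suc m)
      have t: "Poly_Mapping.lookup x m *\<^sub>R ?b m \<in> coord_space n"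
        using Suc.prems b by (intro subspace_scale[OF subspace_coord_space]) auto
      have s: "?s m \<in> coord_space n" "p (?s m) \<le> (\<Sum>i<m. \<bar>Poly_Mapping.lookup x i\<bar> * p (?b i))"
        using Suc by auto
      have "p (?s m + Poly_Mapping.lookup x m *\<^sub>R ?b m)
          \<le> p (?s m) + \<bar>Poly_Mapping.lookup x m\<bar> * p (?b m)"
        using norm_on_triangle[OF p s(1) t] norm_on_scaleR[OF p b] Suc.prems by simp
      then show ?case
        using s subspace_add[OF subspace_coord_space s(1) t] by simp
    qed
    from this[of n] have "p x \<le> (\<Sum>i<n. \<bar>Poly_Mapping.lookup x i\<bar> * p (?b i))"
      using coord_space_expand[OF x] by simp
    also have "\<dots> \<le> (\<Sum>i<n. norm x * p (?b i))"
      using pb by (intro sum_mono mult_right_mono abs_lookup_le_norm) auto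
    also have "\<dots> \<le> K * norm x"
      by (simp add: K_def sum_distrib_left[symmetric] algebra_simps)
    finally show ?thesis .
  qed
qed

text \<open>The l1 unit sphere of \<open>coord_space n\<close> is compact and p is Lipschitz by the
  previous bound, so p has a positive minimum on the sphere; homogeneity does the rest.\<close>

lemma norm_le_norm_on:
  assumes p: "norm_on (coord_space n) p"
  obtains C where "C > 0" "\<And>x. x \<in> coord_space n \<Longrightarrow> norm x \<le> C * p x"
proof -
  obtain K where K: "K > 0" "\<And>x. x \<in> coord_space n \<Longrightarrow> p x \<le> K * norm x"
    using norm_on_le_norm[OF p] by blast
  note sub = subspace_coord_space[of n]
  define S where "S = {x \<in> coord_space n. norm x = 1}"
  \<comment> \<open>The ambient space \<open>seq_vec\<close> is infinite-dimensional, so closed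
    bounded sets need not be compact in it. Compactness comes instead from the convex hull of
    finitely many points, of which S is a closed subset.\<close>
  have "S = convex hull (cross_vertices n) \<inter> (coord_space n \<inter> {x. norm x = 1})"
    using unit_ball_subset_cross_hull by (auto simp: S_def)
  moreover have "closed {x :: seq_vec. norm x = 1}"
    by (intro closed_Collect_eq continuous_intros)
  ultimately have comp: "compact S"
    using closed_coord_space finite_imp_compact_convex_hull[OF finite_cross_vertices]
    by (simp add: compact_Int_closed closed_Int)
  have lip: "\<bar>p x - p y\<bar> \<le> K * norm (x - y)" if "x \<in> coord_space n" "y \<in> coord_space n" for x y
  proof -
    have d: "x - y \<in> coord_space n" "y - x \<in> coord_space n"
      using that subspace_diff[OF sub] by auto
    show ?thesis
      using norm_on_triangle[OF p d(1) that(2)] norm_on_triangle[OF p d(2) that(1)]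
        K(2)[OF d(1)] K(2)[OF d(2)] by (simp add: norm_minus_commute)
  qed
  have "continuous_on S p"
  proof (rule continuous_onI)
    fix x and e :: real assume "x \<in> S" "0 < e"
    then show "\<exists>d>0. \<forall>x'\<in>S. dist x' x < d \<longrightarrow> dist (p x') (p x) \<le> e"
      using K(1) by (intro exI[of _ "e / K"])
        (auto simp: S_def dist_norm field_simps intro!: order_trans[OF lip])
  qed
  show ?thesis
  proof (cases "S = {}")
    \<comment> \<open>An empty sphere means that the space is trivial, that is, n = 0.\<close>
    case True
    have "x = 0" if "x \<in> coord_space n" for x
    proof (rule ccontr)
      assume "x \<noteq> 0"
      then have "(1 / norm x) *\<^sub>R x \<in> S"
        using that by (simp add: S_def subspace_scale[OF sub])
      then show False
        using True by blast
    qed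
    then have "norm x \<le> 1 * p x" if "x \<in> coord_space n" for x
      using that norm_on_zero[OF p sub] by fastforce
    then show ?thesis
      using that[of 1] by simp
  next
    case False
    then obtain z where z: "z \<in> S" "\<And>y. y \<in> S \<Longrightarrow> p z \<le> p y"
      using continuous_attains_inf[OF comp] \<open>continuous_on S p\<close> by blast
    have "z \<noteq> 0" "z \<in> coord_space n"
      using z(1) by (auto simp: S_def)
    then have pz: "p z > 0"
      using norm_on_nonneg[OF p, of z] norm_on_eq_0[OF p, of z] by linarith
    have "norm x \<le> (1 / p z) * p x" if x: "x \<in> coord_space n" for x
    proof (cases "x = 0")
      case True
      then show ?thesis
        using norm_on_zero[OF p sub] by simp
    next
      case False
      then have "(1 / norm x) *\<^sub>R x \<in> S"
        using x by (simp add: S_def subspace_scale[OF sub])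
      then have "p z \<le> (1 / norm x) * p x"
        using z(2) norm_on_scaleR[OF p x, of "1 / norm x"] by fastforce
      then show ?thesis
        using pz False by (simp add: field_simps)
    qed
    then show ?thesis
      using that[of "1 / p z"] pz by simp
  qed
qed

section \<open>Rational polytopes inside the unit ball of a norm\<close>

lemma finite_grid:
  fixes M R :: real
  assumes "M > 0"
  shows "finite {v \<in> coord_space n. norm v \<le> R \<and> (\<forall>i. M * Poly_Mapping.lookup v i \<in> \<int>)}" (is "finite ?G")
proof -
  define J where "J = {k :: int. \<bar>real_of_int k\<bar> \<le> M * R}"
  have "J \<subseteq> {- \<lceil>M * R\<rceil> .. \<lceil>M * R\<rceil>}"
    by (auto simp: J_def abs_le_iff) linarith+
  then have "finite J"
    by (rule finite_subset) simp
  define h where "h f = (\<Sum>i<n. (real_of_int (f i) / M) *\<^sub>R Poly_Mapping.single i (1::real))" for f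
  have "?G \<subseteq> h ` ({..<n} \<rightarrow>\<^sub>E J)"
  proof
    fix v assume v: "v \<in> ?G"
    define f where "f = restrict (\<lambda>i. \<lfloor>M * Poly_Mapping.lookup v i\<rfloor>) {..<n}"
    have "M * Poly_Mapping.lookup v i \<in> \<int>" for i
      using v by blast
    then have fl: "real_of_int \<lfloor>M * Poly_Mapping.lookup v i\<rfloor> = M * Poly_Mapping.lookup v i" for i
      by (metis Ints_cases floor_of_int)
    have "\<bar>M * Poly_Mapping.lookup v i\<bar> \<le> M * R" for i
      using abs_lookup_le_norm[of v i] v assms by (simp add: abs_mult)
    then have "f \<in> {..<n} \<rightarrow>\<^sub>E J"
      by (auto simp: f_def J_def fl)
    moreover have "h f = v"
      using coord_space_expand[of v n] v assms by (simp add: h_def f_def fl)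
    ultimately show "v \<in> h ` ({..<n} \<rightarrow>\<^sub>E J)"
      by blast
  qed
  then show ?thesis
    using \<open>finite J\<close> by (meson finite_PiE finite_imageI finite_lessThan finite_subset)
qed

text \<open>V consists of all points of a fine grid in the unit ball of p. A point x with
  \<open>p x \<le> r\<close> is rounded down to a grid point v; then x lies in a small
  cross-polytope around v whose vertices are again grid points, and these are so near x that p is at
  most 1 on them.\<close>

lemma rational_polytope_approximation:
  fixes r :: real
  assumes p: "norm_on (coord_space n) p" and r: "r < 1"
  obtains V where "finite V" "V \<subseteq> rat_points n" "\<And>v. v \<in> V \<Longrightarrow> - v \<in> V" "\<And>v. v \<in> V \<Longrightarrow> p v \<le> 1"
    "\<And>x. x \<in> coord_space n \<Longrightarrow> p x \<le> r \<Longrightarrow> x \<in> convex hull V"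
proof -
  obtain K where K: "K > 0" "\<And>x. x \<in> coord_space n \<Longrightarrow> p x \<le> K * norm x"
    using norm_on_le_norm[OF p] by blast
  obtain C where C: "C > 0" "\<And>x. x \<in> coord_space n \<Longrightarrow> norm x \<le> C * p x"
    using norm_le_norm_on[OF p] by blast
  note sub = subspace_coord_space[of n]
  obtain m :: nat where m: "2 * K * real (Suc n) / (1 - r) < real m"
    using reals_Archimedean2 by blast
  have m0: "real m > 0"
    using m K r by (smt (verit) divide_nonneg_pos mult_nonneg_nonneg of_nat_0_le_iff)
  \<comment> \<open>Rounding to multiples of 1/m costs at most n/m in the l1 norm. Taking n + 1
    instead of n makes \<rho> positive, and \<rho> is an integer multiple of the mesh, so adding
    \<rho> times a cross-polytope vertex stays on the grid.\<close>
  define \<rho> where "\<rho> = real (Suc n) / real m"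
  have \<rho>: "\<rho> > 0" "2 * K * \<rho> \<le> 1 - r"
    using m m0 r by (simp_all add: \<rho>_def field_simps)
  define V where "V = {v \<in> coord_space n. p v \<le> 1 \<and> (\<forall>i. real m * Poly_Mapping.lookup v i \<in> \<int>)}"
  show ?thesis
  proof
    have "V \<subseteq> {v \<in> coord_space n. norm v \<le> C \<and> (\<forall>i. real m * Poly_Mapping.lookup v i \<in> \<int>)}"
      using C by (fastforce simp: V_def intro: order_trans)
    then show "finite V"
      using finite_grid[OF m0] finite_subset by blast
    show "V \<subseteq> rat_points n"
    proof
      fix v assume v: "v \<in> V"
      have "real m * Poly_Mapping.lookup v i / real m \<in> \<rat>" for i
        using v Ints_subset_Rats by (intro Rats_divide) (auto simp: V_def)
      then show "v \<in> rat_points n"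
        using v m0 by (auto simp: V_def rat_points_def)
    qed
    show "- v \<in> V" if "v \<in> V" for v
      using that norm_on_minus[OF p] by (simp add: V_def subspace_neg[OF sub])
    show "p v \<le> 1" if "v \<in> V" for v
      using that by (simp add: V_def)
    show "x \<in> convex hull V" if x: "x \<in> coord_space n" "p x \<le> r" for x
    proof -
      define v where "v = (\<Sum>i<n. (real_of_int \<lfloor>real m * Poly_Mapping.lookup x i\<rfloor> / real m)
          *\<^sub>R Poly_Mapping.single i (1::real))"
      have lv: "Poly_Mapping.lookup v i
          = (if i < n then real_of_int \<lfloor>real m * Poly_Mapping.lookup x i\<rfloor> / real m else 0)" for i
      proof -
        have "Poly_Mapping.lookup v i = (\<Sum>k<n. if k = i then
            real_of_int \<lfloor>real m * Poly_Mapping.lookup x i\<rfloor> / real m else 0)"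
          unfolding v_def lookup_sum by (intro sum.cong) (auto simp: lookup_single when_def)
        then show ?thesis
          by simp
      qed
      have v: "v \<in> coord_space n"
        by (simp add: coord_space_def lv)
      have xv: "x - v \<in> coord_space n"
        using subspace_diff[OF sub x(1) v] .
      have "\<bar>Poly_Mapping.lookup (x - v) i\<bar> \<le> 1 / real m" if "i < n" for i
      proof -
        have "Poly_Mapping.lookup (x - v) i
            = (real m * Poly_Mapping.lookup x i - \<lfloor>real m * Poly_Mapping.lookup x i\<rfloor>) / real m"
          using m0 that by (simp add: lookup_minus lv field_simps)
        moreover have "\<bar>real m * Poly_Mapping.lookup x i - \<lfloor>real m * Poly_Mapping.lookup x i\<rfloor>\<bar> \<le> 1"
          by linarith
        ultimately show ?thesis
          using m0 by (simp add: divide_right_mono)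
      qed
      then have "norm (x - v) \<le> (\<Sum>i<n. 1 / real m)"
        unfolding norm_coord_space[OF xv] by (intro sum_mono) auto
      also have "\<dots> \<le> \<rho>"
        using m0 by (simp add: \<rho>_def divide_right_mono)
      finally have nxv: "norm (x - v) \<le> \<rho>" .
      have "(1 / \<rho>) *\<^sub>R (x - v) \<in> convex hull cross_vertices n"
        using nxv \<rho> xv by (intro unit_ball_subset_cross_hull subspace_scale[OF sub]) auto
      then have "v + \<rho> *\<^sub>R ((1 / \<rho>) *\<^sub>R (x - v)) \<in> (\<lambda>s. v + \<rho> *\<^sub>R s) ` (convex hull cross_vertices n)"
        by blast
      then have "x \<in> convex hull ((\<lambda>s. v + \<rho> *\<^sub>R s) ` cross_vertices n)"
        using \<rho> by (simp add: convex_hull_affinity)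
      moreover have "(\<lambda>s. v + \<rho> *\<^sub>R s) ` cross_vertices n \<subseteq> V"
      proof clarify
        fix s assume s: "s \<in> cross_vertices n"
        then have sc: "s \<in> coord_space n"
          using cross_vertices_subset by blast
        define w where "w = v + \<rho> *\<^sub>R s"
        have w: "w \<in> coord_space n"
          unfolding w_def using v sc by (intro subspace_add[OF sub] subspace_scale[OF sub])
        have wx: "w - x \<in> coord_space n"
          using subspace_diff[OF sub w x(1)] .
        \<comment> \<open>One \<rho> is the rounding error and one is the size of the
          cross-polytope. By the choice of m this costs at most 1 - r in p.\<close>
        have "norm (w - x) \<le> norm (v - x) + norm (\<rho> *\<^sub>R s)"
          unfolding w_def by (metis add_diff_eq add.commute norm_triangle_ineq)
        also have "\<dots> \<le> \<rho> + \<rho> * 1"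
          using nxv \<rho> norm_cross_vertices[OF s] by (intro add_mono) (auto simp: norm_minus_commute)
        finally have "p (w - x) \<le> K * (2 * \<rho>)"
          using K(2)[OF wx] K(1) by (smt (verit) mult_left_mono)
        then have "p w \<le> 1"
          using norm_on_triangle[OF p wx x(1)] x(2) \<rho> by simp
        moreover have "real m * Poly_Mapping.lookup w i \<in> \<int>" for i
        proof -
          have "real m * Poly_Mapping.lookup w i
              = real m * Poly_Mapping.lookup v i + real (Suc n) * Poly_Mapping.lookup s i"
            using m0 by (simp add: w_def lookup_add \<rho>_def field_simps)
          moreover have "Poly_Mapping.lookup s i \<in> \<int>"
            using lookup_cross_vertices[OF s, of i] by auto
          moreover have "real m * Poly_Mapping.lookup v i \<in> \<int>"
            using m0 by (simp add: lv)
          ultimately show ?thesis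
            by simp
        qed
        ultimately show "v + \<rho> *\<^sub>R s \<in> V"
          using w by (simp add: V_def w_def[symmetric])
      qed
      ultimately show ?thesis
        using hull_mono by blast
    qed
  qed
qed

text \<open>The new norm is the Minkowski functional of \<open>B\<close>.\<close>

lemma norm_on_of_unit_ball:
  fixes B :: "'a::real_normed_vector set"
  assumes V: "subspace V" and p: "norm_on V p"
    and B: "B \<subseteq> V" "closed B" "convex B" "\<And>x. x \<in> B \<Longrightarrow> - x \<in> B"
    and r: "r > 0"
    and inner: "\<And>x. x \<in> V \<Longrightarrow> p x \<le> r \<Longrightarrow> x \<in> B"
    and outer: "\<And>x. x \<in> B \<Longrightarrow> p x \<le> 1"
  obtains q where "norm_on V q" "{x \<in> V. q x \<le> 1} = B"
    "\<And>x. x \<in> V \<Longrightarrow> p x \<le> q x" "\<And>x. x \<in> V \<Longrightarrow> r * q x \<le> p x"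
proof -
  \<comment> \<open>\<open>S x\<close> collects the scales t > 0 at which x lies in t times
    B.\<close>
  define S where "S x = {t. t > 0 \<and> (1 / t) *\<^sub>R x \<in> B}" for x
  define q where "q x = Inf (S x)" for x
  have zB: "0 \<in> B"
    using inner[of 0] norm_on_zero[OF p V] subspace_0[OF V] r by simp
  have bdd: "bdd_below (S x)" for x
    by (rule bdd_belowI[of _ 0]) (simp add: S_def)
  have S_mem: "t \<in> S x" if "x \<in> V" "t > 0" "p x \<le> r * t" for x t
    using that inner[of "(1 / t) *\<^sub>R x"] subspace_scale[OF V] norm_on_scaleR[OF p]
    by (simp add: S_def field_simps)
  have S_ne: "S x \<noteq> {}" if x: "x \<in> V" for x
  proof -
    have "p x / r + 1 \<in> S x"
      using x r norm_on_nonneg[OF p x] by (intro S_mem) (auto simp: field_simps add_pos_nonneg)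
    then show ?thesis
      by blast
  qed
  have p_le: "p x \<le> t" if "x \<in> V" "t \<in> S x" for x t
    using that outer[of "(1 / t) *\<^sub>R x"] norm_on_scaleR[OF p, of x "1 / t"]
    by (simp add: S_def field_simps)
  have le_q: "p x \<le> q x" if "x \<in> V" for x
    unfolding q_def using S_ne p_le that by (intro cInf_greatest) auto
  have nn: "0 \<le> q x" if "x \<in> V" for x
    using le_q norm_on_nonneg[OF p] that order_trans by blast
  \<comment> \<open>Upward closure: x/t' is a convex combination of 0 and x/t.\<close>
  have up: "t' \<in> S x" if "t \<in> S x" "t < t'" for t t' x
  proof -
    have t: "0 < t" "(1 / t) *\<^sub>R x \<in> B"
      using that by (auto simp: S_def)
    have "(1 - t / t') *\<^sub>R 0 + (t / t') *\<^sub>R ((1 / t) *\<^sub>R x) \<in> B"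
      using t that zB by (intro convexD[OF B(3)]) auto
    then show ?thesis
      using t that by (simp add: S_def)
  qed
  have up': "t \<in> S x" if "x \<in> V" "q x < t" for t x
    using that cInf_lessD[OF S_ne] up unfolding q_def by blast
  \<comment> \<open>Since B is closed, a positive infimum is attained: the points x/t converge to
    x/q(x) as t decreases to q(x).\<close>
  have attained: "(1 / q x) *\<^sub>R x \<in> B" if x: "x \<in> V" "q x > 0" for x
  proof (rule Lim_in_closed_set[OF B(2)])
    let ?t = "\<lambda>n. q x + 1 / real (Suc n)"
    show "\<forall>\<^sub>F n in sequentially. (1 / ?t n) *\<^sub>R x \<in> B"
      using up'[OF x(1), of "?t n" for n] by (intro always_eventually) (auto simp: S_def)
    have "(\<lambda>n. q x + inverse (real (Suc n))) \<longlonglongrightarrow> q x + 0"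
      by (intro tendsto_intros LIMSEQ_inverse_real_of_nat)
    then have "?t \<longlonglongrightarrow> q x"
      by (simp add: inverse_eq_divide)
    then show "(\<lambda>n. (1 / ?t n) *\<^sub>R x) \<longlonglongrightarrow> (1 / q x) *\<^sub>R x"
      using x(2) by (intro tendsto_intros) auto
  qed auto
  have zero: "q x = 0 \<longleftrightarrow> x = 0" if x: "x \<in> V" for x
  proof
    show "x = 0" if "q x = 0"
      using le_q[OF x] norm_on_nonneg[OF p x] norm_on_eq_0[OF p x] that by linarith
    show "q x = 0" if "x = 0"
    proof -
      have "q x \<le> e" if "e > 0" for e
        unfolding q_def using zB \<open>x = 0\<close> that by (intro cInf_lower bdd) (simp add: S_def)
      then show ?thesis
        using nn[OF x] by (metis dense_ge order_antisym)
    qed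
  qed
  have scale_le: "q (c *\<^sub>R x) \<le> \<bar>c\<bar> * q x" if x: "x \<in> V" for c x
  proof (cases "c = 0")
    case True
    then show ?thesis
      using zero[OF subspace_0[OF V]] by simp
  next
    case False
    have "q (c *\<^sub>R x) \<le> \<bar>c\<bar> * t" if t: "q x < t" for t
    proof -
      have t: "0 < t" "(1 / t) *\<^sub>R x \<in> B"
        using up'[OF x t] by (auto simp: S_def)
      then have "(1 / (\<bar>c\<bar> * t)) *\<^sub>R (c *\<^sub>R x) \<in> B"
        using B(4)[OF t(2)] False by (cases "c > 0") auto
      then show ?thesis
        unfolding q_def using False t by (intro cInf_lower bdd) (simp add: S_def)
    qed
    then have "q (c *\<^sub>R x) / \<bar>c\<bar> \<le> t" if "q x < t" for t
      using False that by (simp add: field_simps)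
    then have "q (c *\<^sub>R x) / \<bar>c\<bar> \<le> q x"
      by (rule dense_ge)
    then show ?thesis
      using False by (simp add: field_simps)
  qed
  have scale: "q (c *\<^sub>R x) = \<bar>c\<bar> * q x" if x: "x \<in> V" for c x
  proof (cases "c = 0")
    case True
    then show ?thesis
      using zero[OF subspace_0[OF V]] by simp
  next
    case False
    \<comment> \<open>The reverse inequality is the one already proved, applied to the scalar
      1/c.\<close>
    have "q ((1 / c) *\<^sub>R (c *\<^sub>R x)) \<le> \<bar>1 / c\<bar> * q (c *\<^sub>R x)"
      by (rule scale_le) (rule subspace_scale[OF V x])
    then have "\<bar>c\<bar> * q x \<le> q (c *\<^sub>R x)"
      using False by (simp add: field_simps)
    then show ?thesis
      using scale_le[OF x, of c] by simp
  qed
  have tri: "q (x + y) \<le> q x + q y" if xy: "x \<in> V" "y \<in> V" for x y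
  proof -
    have "q (x + y) \<le> s" if s: "q x + q y < s" for s
    proof -
      \<comment> \<open>The infima may fail to be attained at 0, so the slack is split evenly to
        give scales a and b strictly above them. Then (x+y)/(a+b) is the convex combination of x/a
        and y/b with weights a/(a+b) and b/(a+b).\<close>
      define e where "e = (s - q x - q y) / 2"
      have e: "e > 0" "s = (q x + e) + (q y + e)"
        using s by (auto simp: e_def field_simps)
      define a b where "a = q x + e" and "b = q y + e"
      have ab: "a > 0" "b > 0" "(1 / a) *\<^sub>R x \<in> B" "(1 / b) *\<^sub>R y \<in> B"
        using up'[OF xy(1), of a] up'[OF xy(2), of b] e by (auto simp: a_def b_def S_def)
      have "a / (a + b) + b / (a + b) = (a + b) / (a + b)"
        by (simp only: add_divide_distrib)
      then have sum1: "a / (a + b) + b / (a + b) = 1"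
        using ab by simp
      have "(a / (a + b)) *\<^sub>R ((1 / a) *\<^sub>R x) + (b / (a + b)) *\<^sub>R ((1 / b) *\<^sub>R y) \<in> B"
        using ab sum1 by (intro convexD[OF B(3)]) auto
      then have "(1 / (a + b)) *\<^sub>R (x + y) \<in> B"
        using ab by (simp add: scaleR_add_right)
      then have "a + b \<in> S (x + y)"
        using ab by (simp add: S_def)
      then show ?thesis
        unfolding q_def e(2) using bdd by (intro cInf_lower) (auto simp: a_def b_def q_def)
    qed
    then show ?thesis
      by (rule dense_ge)
  qed
  show ?thesis
  proof
    show "norm_on V q"
      using nn zero scale tri by (simp add: norm_on_def)
    show "{x \<in> V. q x \<le> 1} = B"
    proof (intro equalityI subsetI)
      fix x assume "x \<in> {x \<in> V. q x \<le> 1}"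
      then have x: "x \<in> V" "q x \<le> 1"
        by auto
      show "x \<in> B"
      proof (cases "x = 0")
        case False
        then have qx: "q x > 0"
          using nn[OF x(1)] zero[OF x(1)] by linarith
        have "(1 - q x) *\<^sub>R 0 + q x *\<^sub>R ((1 / q x) *\<^sub>R x) \<in> B"
          using attained[OF x(1) qx] qx x zB by (intro convexD[OF B(3)]) auto
        then show ?thesis
          using qx by simp
      qed (simp add: zB)
    next
      fix x assume x: "x \<in> B"
      then have "q x \<le> 1"
        unfolding q_def by (intro cInf_lower bdd) (simp add: S_def)
      then show "x \<in> {x \<in> V. q x \<le> 1}"
        using x B(1) by auto
    qed
    show "p x \<le> q x" if "x \<in> V" for x
      using le_q that .
    show "r * q x \<le> p x" if x: "x \<in> V" for x
    proof -
      have "q x \<le> t" if t: "p x / r < t" for t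
      proof -
        have "0 < t"
          using t norm_on_nonneg[OF p x] r by (meson divide_nonneg_pos le_less_trans)
        then show ?thesis
          unfolding q_def using t r x by (intro cInf_lower bdd S_mem) (auto simp: field_simps)
      qed
      then have "q x \<le> p x / r"
        by (rule dense_ge)
      then show ?thesis
        using r by (simp add: field_simps)
    qed
  qed
qed

section \<open>Truncation, and rational norms extending a given one\<close>

definition trunc :: "nat \<Rightarrow> seq_vec \<Rightarrow> seq_vec" where
  "trunc n x = (\<Sum>i<n. Poly_Mapping.lookup x i *\<^sub>R Poly_Mapping.single i 1)"

lemma lookup_trunc: "Poly_Mapping.lookup (trunc n x) i = (if i < n then Poly_Mapping.lookup x i else 0)"
proof -
  have "Poly_Mapping.lookup (trunc n x) i = (\<Sum>k<n. if k = i then Poly_Mapping.lookup x i else 0)"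
    unfolding trunc_def lookup_sum by (intro sum.cong) (auto simp: lookup_single when_def)
  then show ?thesis
    by simp
qed

lemma trunc_in_coord_space: "trunc n x \<in> coord_space n"
  by (simp add: coord_space_def lookup_trunc)

lemma trunc_id: "x \<in> coord_space n \<Longrightarrow> trunc n x = x"
  by (rule poly_mapping_eqI) (auto simp: coord_space_def lookup_trunc)

lemma trunc_add: "trunc n (x + y) = trunc n x + trunc n y"
  by (rule poly_mapping_eqI) (simp add: lookup_trunc lookup_add)

lemma trunc_scaleR: "trunc n (c *\<^sub>R x) = c *\<^sub>R trunc n x"
  by (rule poly_mapping_eqI) (simp add: lookup_trunc)

lemma trunc_minus: "trunc n (x - y) = trunc n x - trunc n y"
  by (rule poly_mapping_eqI) (simp add: lookup_trunc lookup_minus)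

text \<open>
  The polytope is the convex hull of the unit ball of \<open>E\<close> and a rational polytope inside
  the unit ball of \<open>p\<close>; adding the unit ball of \<open>E\<close> keeps the inclusion isometric.
\<close>

lemma rational_extension_approximation:
  assumes E: "rational_space E" and le: "sp_dim E \<le> n" and p: "norm_on (coord_space n) p"
    and pE: "\<And>x. x \<in> carr E \<Longrightarrow> p x = sp_norm E x"
    and ptr: "\<And>x. x \<in> coord_space n \<Longrightarrow> p (trunc (sp_dim E) x) \<le> p x"
    and r: "0 < r" "r < 1"
  obtains Y where "rational_space Y" "sp_dim Y = n" "is_arrow E Y (id, trunc (sp_dim E))"
    "\<And>x. x \<in> coord_space n \<Longrightarrow> p x \<le> sp_norm Y x"
    "\<And>x. x \<in> coord_space n \<Longrightarrow> r * sp_norm Y x \<le> p x"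
proof -
  note sub = subspace_coord_space[of n]
  have EY: "carr E \<subseteq> coord_space n"
    using coord_space_mono[OF le] by (simp add: carr_def)
  obtain V where V: "finite V" "V \<subseteq> rat_points n" "\<And>v. v \<in> V \<Longrightarrow> - v \<in> V" "\<And>v. v \<in> V \<Longrightarrow> p v \<le> 1"
    "\<And>x. x \<in> coord_space n \<Longrightarrow> p x \<le> r \<Longrightarrow> x \<in> convex hull V"
    using rational_polytope_approximation[OF p r(2)] by blast
  obtain W where W: "finite W" "W \<subseteq> rat_points (sp_dim E)"
    "{x \<in> carr E. sp_norm E x \<le> 1} = convex hull W" and nE: "norm_on (carr E) (sp_norm E)"
    using E by (auto simp: rational_space_def)
  \<comment> \<open>Adjoining the negatives of W makes the symmetry of B immediate, whichever finite
    set W presents the unit ball of E.\<close>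
  define B where "B = convex hull (W \<union> uminus ` W \<union> V)"
  have Wb: "w \<in> carr E" "sp_norm E w \<le> 1" if "w \<in> W" for w
    using that W(3) hull_inc[of w W convex] by auto
  have ratW: "W \<subseteq> rat_points n"
    using W(2) coord_space_mono[OF le] by (auto simp: rat_points_def)
  have ratB: "W \<union> uminus ` W \<union> V \<subseteq> rat_points n"
    using ratW V(2) by (auto simp: rat_points_def coord_space_def)
  have ball: "W \<union> uminus ` W \<union> V \<subseteq> {x \<in> coord_space n. p x \<le> 1}"
  proof -
    have "w \<in> coord_space n" "p w \<le> 1" if "w \<in> W" for w
      using Wb[OF that] pE EY by auto
    then show ?thesis
      using V(2,4) norm_on_minus[OF p] subspace_neg[OF sub] by (auto simp: rat_points_def)
  qed
  have conv_ball: "convex {x \<in> coord_space n. p x \<le> 1}"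
  proof (rule convexI)
    fix x y and u v :: real
    assume *: "x \<in> {x \<in> coord_space n. p x \<le> 1}" "y \<in> {x \<in> coord_space n. p x \<le> 1}"
      "0 \<le> u" "0 \<le> v" "u + v = 1"
    have s: "u *\<^sub>R x \<in> coord_space n" "v *\<^sub>R y \<in> coord_space n"
      using * subspace_scale[OF sub] by auto
    have "p (u *\<^sub>R x + v *\<^sub>R y) \<le> u * p x + v * p y"
      using norm_on_triangle[OF p s] norm_on_scaleR[OF p] * by simp
    also have "\<dots> \<le> u * 1 + v * 1"
      using * by (intro add_mono mult_left_mono) auto
    finally show "u *\<^sub>R x + v *\<^sub>R y \<in> {x \<in> coord_space n. p x \<le> 1}"
      using * s subspace_add[OF sub] by simp
  qed
  have B_ball: "B \<subseteq> {x \<in> coord_space n. p x \<le> 1}"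
    unfolding B_def by (rule hull_minimal, rule ball, rule conv_ball)
  have fin: "finite (W \<union> uminus ` W \<union> V)"
    using W(1) V(1) by simp
  have B_closed: "closed B"
    unfolding B_def by (rule compact_imp_closed[OF finite_imp_compact_convex_hull[OF fin]])
  have B_sym: "- x \<in> B" if "x \<in> B" for x
  proof -
    have "uminus ` V = V"
      using V(3) by (metis (no_types, lifting) add.inverse_inverse image_eqI image_subsetI subset_antisym subsetI)
    then have "uminus ` (W \<union> uminus ` W \<union> V) = W \<union> uminus ` W \<union> V"
      by (simp add: image_Un image_image Un_commute)
    then have "convex hull (W \<union> uminus ` W \<union> V) = uminus ` (convex hull (W \<union> uminus ` W \<union> V))"
      using convex_hull_scaling[of "-1" "W \<union> uminus ` W \<union> V"] by simp
    then show ?thesis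
      using that unfolding B_def by blast
  qed
  obtain q where q: "norm_on (coord_space n) q" "{x \<in> coord_space n. q x \<le> 1} = B"
    "\<And>x. x \<in> coord_space n \<Longrightarrow> p x \<le> q x" "\<And>x. x \<in> coord_space n \<Longrightarrow> r * q x \<le> p x"
  proof (rule norm_on_of_unit_ball[OF sub p, of B r])
    show "x \<in> B" if "x \<in> coord_space n" "p x \<le> r" for x
      using V(5)[OF that] hull_mono[of V "W \<union> uminus ` W \<union> V" convex] unfolding B_def by blast
  qed (use B_ball B_closed B_sym r in \<open>auto simp: B_def\<close>)
  define Y where "Y = \<lparr>sp_dim = n, sp_norm = q\<rparr>"
  have Y: "sp_dim Y = n" "sp_norm Y = q" "carr Y = coord_space n"
    by (auto simp: Y_def carr_def)
  \<comment> \<open>Enlarging the polytope to contain the unit ball of E gives q at most the norm of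
    E; the other inequality holds because q dominates p.\<close>
  have qE: "q x = sp_norm E x" if x: "x \<in> carr E" for x
  proof (rule order_antisym)
    have xn: "x \<in> coord_space n"
      using x EY by blast
    show "sp_norm E x \<le> q x"
      using q(3)[OF xn] pE[OF x] by simp
    have subE: "subspace (carr E)"
      by (simp add: carr_def subspace_coord_space)
    show "q x \<le> sp_norm E x"
    proof (cases "x = 0")
      case True
      then show ?thesis
        using norm_on_zero[OF q(1) sub] norm_on_zero[OF nE subE] by simp
    next
      case False
      then have pos: "sp_norm E x > 0"
        using norm_on_nonneg[OF nE x] norm_on_eq_0[OF nE x] by linarith
      let ?y = "(1 / sp_norm E x) *\<^sub>R x"
      have "?y \<in> carr E" "sp_norm E ?y \<le> 1"
        using pos x norm_on_scaleR[OF nE x] subspace_scale[OF subE] by auto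
      then have "?y \<in> convex hull W"
        using W(3) by blast
      then have "?y \<in> B"
        using hull_mono[of W "W \<union> uminus ` W \<union> V" convex] unfolding B_def by blast
      then have "q ?y \<le> 1"
        using q(2) by blast
      then show ?thesis
        using norm_on_scaleR[OF q(1) xn, of "1 / sp_norm E x"] pos by (simp add: field_simps)
    qed
  qed
  show ?thesis
  proof
    show "rational_space Y"
      unfolding rational_space_def Y
      by (intro conjI exI[of _ "W \<union> uminus ` W \<union> V"]) (use q(1) q(2)[unfolded B_def] fin ratB in simp_all)
    show "sp_dim Y = n"
      by (rule Y)
    have "rational_1_bounded E Y id"
      using EY qE coord_space_mono[OF le]
      by (auto simp: rational_1_bounded_def Y linear_map_on_def rat_points_def)
    moreover have "rational_1_bounded Y E (trunc (sp_dim E))"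
    proof -
      have "sp_norm E (trunc (sp_dim E) x) \<le> q x" if "x \<in> coord_space n" for x
        using ptr[OF that] q(3)[OF that] pE[of "trunc (sp_dim E) x"]
        by (simp add: carr_def trunc_in_coord_space)
      then show ?thesis
        by (auto simp: rational_1_bounded_def Y linear_map_on_def rat_points_def trunc_in_coord_space
            carr_def trunc_add trunc_scaleR lookup_trunc)
    qed
    ultimately show "is_arrow E Y (id, trunc (sp_dim E))"
      using qE by (simp add: is_arrow_def Y trunc_id carr_def)
  qed (use q Y in auto)
qed

subsection \<open>Amalgamation\<close>

text \<open>Homogeneity and subadditivity of g hold jointly in both arguments, so they survive
  minimising over the second. This yields the norm of the amalgam, where x ranges over the ways to
  shift a vector from one summand to the other.\<close>

lemma infimum_seminorm:
  fixes g :: "'a::real_vector \<Rightarrow> 'b::real_vector \<Rightarrow> real"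
  assumes V: "subspace V"
    and nonneg: "\<And>w x. w \<in> V \<Longrightarrow> 0 \<le> g w x"
    and scale: "\<And>w x c. w \<in> V \<Longrightarrow> g (c *\<^sub>R w) (c *\<^sub>R x) = \<bar>c\<bar> * g w x"
    and tri: "\<And>w w' x x'. w \<in> V \<Longrightarrow> w' \<in> V \<Longrightarrow> g (w + w') (x + x') \<le> g w x + g w' x'"
  defines "N \<equiv> \<lambda>w. INF x. g w x"
  shows infimum_seminorm_le: "w \<in> V \<Longrightarrow> N w \<le> g w x"
    and infimum_seminorm_scaleR: "w \<in> V \<Longrightarrow> N (c *\<^sub>R w) = \<bar>c\<bar> * N w"
    and infimum_seminorm_triangle: "w \<in> V \<Longrightarrow> w' \<in> V \<Longrightarrow> N (w + w') \<le> N w + N w'"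
proof -
  have le: "N w \<le> g w x" if "w \<in> V" for w x
    unfolding N_def using nonneg[OF that] by (intro cINF_lower) (auto intro: bdd_belowI[of _ 0])
  then show "w \<in> V \<Longrightarrow> N w \<le> g w x" .
  have ge: "a \<le> N w" if "\<And>x. a \<le> g w x" for a w
    unfolding N_def using that by (intro cINF_greatest) auto
  have scale_le: "\<bar>c\<bar> * N w \<le> N (c *\<^sub>R w)" if w: "w \<in> V" for c w
  proof (rule ge)
    fix x
    show "\<bar>c\<bar> * N w \<le> g (c *\<^sub>R w) x"
    proof (cases "c = 0")
      case True
      then show ?thesis
        using nonneg[OF subspace_0[OF V]] by simp
    next
      case False
      \<comment> \<open>Scaling by c is a bijection of the minimisation variable, so the infimum may
        be taken over multiples of c.\<close>
      then have "g (c *\<^sub>R w) x = \<bar>c\<bar> * g w ((1 / c) *\<^sub>R x)"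
        using scale[OF w, of c "(1 / c) *\<^sub>R x"] by simp
      then show ?thesis
        using le[OF w] by (simp add: mult_left_mono)
    qed
  qed
  have N0: "N 0 \<le> 0"
    using le[OF subspace_0[OF V], of 0] scale[OF subspace_0[OF V], of 0 0] by simp
  show "N (c *\<^sub>R w) = \<bar>c\<bar> * N w" if w: "w \<in> V"
  proof (cases "c = 0")
    case True
    then show ?thesis
      using order_antisym[OF N0 ge[OF nonneg[OF subspace_0[OF V]]]] by simp
  next
    case False
    have "\<bar>1 / c\<bar> * N (c *\<^sub>R w) \<le> N ((1 / c) *\<^sub>R (c *\<^sub>R w))"
      by (rule scale_le) (rule subspace_scale[OF V w])
    then show ?thesis
      using scale_le[OF w, of c] False by (simp add: field_simps)
  qed
  show "N (w + w') \<le> N w + N w'" if w: "w \<in> V" "w' \<in> V"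
  proof -
    \<comment> \<open>The two infima are taken one at a time: first over the variable belonging to
      w, then over the one belonging to w'.\<close>
    have "N (w + w') - g w' x' \<le> N w" for x'
    proof (rule ge)
      show "N (w + w') - g w' x' \<le> g w x" for x
        using le[OF subspace_add[OF V w], of "x + x'"] tri[OF w, of x x'] by linarith
    qed
    then have "N (w + w') - N w \<le> N w'"
      by (intro ge) (simp add: algebra_simps)
    then show ?thesis
      by linarith
  qed
qed

text \<open>This places the range of Q in the d coordinates following the first n. A space carried
  by \<open>coord_space n\<close> then sits literally inside \<open>coord_space (n + d)\<close>, and
  the projection back to it can be truncation, which is visibly rational. The maps
  \<open>\<kappa>\<close> and \<open>\<beta>\<close> write and read the new coordinates.\<close>

lemma finite_rank_coordinates:
  fixes Q :: "'x::real_vector \<Rightarrow> 'x"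
  assumes Q: "linear Q" "\<And>x. Q (Q x) = Q x" "finite_rank Q"
  obtains d :: nat and \<beta> :: "seq_vec \<Rightarrow> 'x" and \<kappa> :: "'x \<Rightarrow> seq_vec" where
    "linear \<beta>" "linear \<kappa>"
    "\<And>w. Q (\<beta> w) = \<beta> w" "\<And>x. \<kappa> (Q x) = \<kappa> x" "\<And>x. \<beta> (\<kappa> x) = Q x"
    "\<And>x. \<kappa> x \<in> coord_space (n + d)" "\<And>x. trunc n (\<kappa> x) = 0"
    "\<And>w. w \<in> coord_space n \<Longrightarrow> \<beta> w = 0"
    "\<And>w. w \<in> coord_space (n + d) \<Longrightarrow> \<kappa> (\<beta> w) = w - trunc n w"
proof -
  obtain F where F: "finite F" "range Q \<subseteq> span F"
    using Q(3) by (auto simp: finite_rank_def)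
  obtain S where S: "S \<subseteq> range Q" "independent S" "range Q \<subseteq> span S"
    by (rule basis_exists[of "range Q"]) (rule that)
  have "finite S"
    using independent_span_bound[OF F(1) S(2)] S(1) F(2) by blast
  define d where "d = card S"
  obtain h where h: "bij_betw h {0..<d} S"
    using ex_bij_betw_nat_finite[OF \<open>finite S\<close>] d_def by blast
  then have h: "bij_betw h {..<d} S"
    by (simp add: atLeast0LessThan)
  define idx where "idx = the_inv_into {..<d} h"
  have hS: "h i \<in> S" and idx: "idx (h i) = i" if "i < d" for i
    using h that by (auto simp: idx_def bij_betw_def intro: the_inv_into_f_f)
  have S_h: "\<exists>i<d. b = h i" if "b \<in> S" for b
    using h that by (auto simp: bij_betw_def)
  define e :: "nat \<Rightarrow> seq_vec" where "e i = Poly_Mapping.single (n + i) 1" for i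
  \<comment> \<open>G sends the basis of the range of Q to the unit vectors n, ..., n+d-1. Its
    values off the span of S are arbitrary, and composing with Q hides them.\<close>
  obtain G where G: "linear G" "\<forall>b\<in>S. G b = e (idx b)"
    using linear_independent_extend[OF S(2), of "\<lambda>b. e (idx b)"] by blast
  define \<beta> where "\<beta> w = (\<Sum>i<d. Poly_Mapping.lookup w (n + i) *\<^sub>R h i)" for w :: seq_vec
  define \<kappa> where "\<kappa> = G \<circ> Q"
  have lin\<beta>: "linear \<beta>"
    by (rule linearI) (simp_all add: \<beta>_def lookup_add algebra_simps sum.distrib scaleR_sum_right)
  have lin\<kappa>: "linear \<kappa>"
    unfolding \<kappa>_def using Q(1) G(1) by (rule linear_compose)
  have Gh: "G (h i) = e i" if "i < d" for i
    using G(2) hS[OF that] idx[OF that] by simp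
  have \<beta>e: "\<beta> (e i) = h i" if "i < d" for i
  proof -
    have "\<beta> (e i) = (\<Sum>k<d. if k = i then h i else 0)"
      unfolding \<beta>_def by (intro sum.cong) (auto simp: e_def lookup_single when_def)
    then show ?thesis
      using that by simp
  qed
  have QS: "Q b = b" if "b \<in> S" for b
    using that S(1) Q(2) by auto
  define T where "T = {w \<in> coord_space (n + d). trunc n w = 0}"
  have T: "subspace T"
    using subspace_coord_space[of "n + d"]
    by (auto simp: T_def subspace_def trunc_add trunc_scaleR intro!: poly_mapping_eqI simp: lookup_trunc)
  have eT: "e i \<in> T" if "i < d" for i
    using that by (auto simp: T_def e_def coord_space_def lookup_single when_def lookup_trunc
        intro!: poly_mapping_eqI)
  have GT: "G x \<in> T" if "x \<in> span S" for x
    using that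
  proof (rule span_induct)
    show "subspace {x. G x \<in> T}"
      using linear_subspace_vimage[OF G(1) T] by (simp add: vimage_def)
    show "G b \<in> T" if "b \<in> S" for b
      using S_h[OF that] Gh eT by auto
  qed
  have \<kappa>T: "\<kappa> x \<in> T" for x
    using GT S(3) by (auto simp: \<kappa>_def)
  show ?thesis
  proof
    show "linear \<beta>" "linear \<kappa>"
      by fact+
    show Q\<beta>: "Q (\<beta> w) = \<beta> w" for w
      by (simp add: \<beta>_def linear_sum[OF Q(1)] linear_scale[OF Q(1)] QS hS)
    show "\<kappa> (Q x) = \<kappa> x" for x
      by (simp add: \<kappa>_def Q(2))
    show "\<beta> (\<kappa> x) = Q x" for x
    proof -
      have "linear (\<beta> \<circ> G)" "linear (id :: 'x \<Rightarrow> 'x)"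
        using linear_compose[OF G(1) lin\<beta>] by (auto intro: linear_id)
      moreover have "(\<beta> \<circ> G) b = id b" if "b \<in> S" for b
        using S_h[OF that] Gh \<beta>e by auto
      moreover have "Q x \<in> span S"
        using S(3) by blast
      ultimately have "(\<beta> \<circ> G) (Q x) = id (Q x)"
        by (rule linear_eq_on_span)
      then show ?thesis
        by (simp add: \<kappa>_def)
    qed
    show "\<kappa> x \<in> coord_space (n + d)" "trunc n (\<kappa> x) = 0" for x
      using \<kappa>T by (auto simp: T_def)
    show "\<beta> w = 0" if "w \<in> coord_space n" for w
      using that by (simp add: \<beta>_def coord_space_def)
    show "\<kappa> (\<beta> w) = w - trunc n w" if w: "w \<in> coord_space (n + d)" for w
    proof -
      have "\<kappa> (\<beta> w) = (\<Sum>i<d. Poly_Mapping.lookup w (n + i) *\<^sub>R e i)"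
        by (simp add: \<kappa>_def Q\<beta>) (simp add: \<beta>_def linear_sum[OF G(1)] linear_scale[OF G(1)] Gh)
      also have "\<dots> = w - trunc n w"
      proof (rule poly_mapping_eqI)
        fix k
        have "Poly_Mapping.lookup (\<Sum>i<d. Poly_Mapping.lookup w (n + i) *\<^sub>R e i) k
            = (\<Sum>i<d. if n \<le> k \<and> i = k - n then Poly_Mapping.lookup w k else 0)"
          unfolding lookup_sum by (intro sum.cong) (auto simp: e_def lookup_single when_def)
        also have "\<dots> = Poly_Mapping.lookup (w - trunc n w) k"
          using w by (cases "n \<le> k") (auto simp: lookup_minus lookup_trunc coord_space_def)
        finally show "Poly_Mapping.lookup (\<Sum>i<d. Poly_Mapping.lookup w (n + i) *\<^sub>R e i) k
            = Poly_Mapping.lookup (w - trunc n w) k" .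
      qed
      finally show ?thesis .
    qed
  qed
qed

text \<open>The range of Q is not made a space of its own: the equations
  \<open>A (Q x) = A x\<close> and \<open>Q (p u) = p u\<close> say that A starts from it and p ends
  in it. As p is a contraction with \<open>p (A x) = Q x\<close>, A cannot shrink norms on that
  range, so it is a \<delta>-isometry there. Neither map has to be rational.\<close>

definition approx_pair ::
    "fin_space \<Rightarrow> ('x::real_normed_vector \<Rightarrow> 'x) \<Rightarrow> real \<Rightarrow> ('x \<Rightarrow> seq_vec) \<Rightarrow> (seq_vec \<Rightarrow> 'x) \<Rightarrow> bool" where
  "approx_pair E Q \<delta> A p \<longleftrightarrow>
     linear A \<and> range A \<subseteq> carr E \<and> (\<forall>x. A (Q x) = A x) \<and>
     (\<forall>x. sp_norm E (A x) \<le> (1 + \<delta>) * norm x) \<and>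
     linear_map_on (carr E) p \<and> (\<forall>u\<in>carr E. Q (p u) = p u \<and> norm (p u) \<le> sp_norm E u) \<and>
     (\<forall>x. p (A x) = Q x)"

text \<open>The amalgam is the sum of E and the range of Q', with the vectors (A x, -Q x) given norm
  at most \<delta> times the norm of Q x. Three maps on pairs (u, y) matter: the projection u + c A
  y to E, the contraction p u + y to the range of Q', and the new embedding sending x to (0, Q' x).
  The coordinates are chosen so that the first is truncation; only then is the norm made
  rational.\<close>

lemma approx_pair_step:
  fixes Q Q' :: "'x::real_normed_vector \<Rightarrow> 'x"
  assumes E: "rational_space E" and ap: "approx_pair E Q \<delta> A p" and \<delta>: "\<delta> > 0" "\<delta>' > 0"
    and Q: "linear Q" "\<And>x. Q (Q x) = Q x" "\<And>x. norm (Q x) \<le> norm x"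
    and Q': "linear Q'" "\<And>x. Q' (Q' x) = Q' x" "finite_rank Q'" "\<And>x. norm (Q' x) \<le> norm x"
    and QQ': "\<And>x. Q (Q' x) = Q x" "\<And>x. Q' (Q x) = Q x"
  obtains Y f A' p' where "rational_space Y" "is_arrow E Y f" "approx_pair Y Q' \<delta>' A' p'"
    "\<And>u. u \<in> carr E \<Longrightarrow> p' (fst f u) = p u"
    "\<And>x. sp_norm Y (A' (Q x) - fst f (A x)) \<le> \<delta> * (1 + \<delta>') * norm x"
proof -
  define n where "n = sp_dim E"
  define c where "c = 1 / (1 + \<delta>)"
  have c: "0 < c" "c < 1" "c * (1 + \<delta>) = 1"
    using \<delta> by (simp_all add: c_def)
  have A: "linear A" "\<And>x. A x \<in> carr E" "\<And>x. A (Q x) = A x"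
      "\<And>x. sp_norm E (A x) \<le> (1 + \<delta>) * norm x"
    and p: "linear_map_on (carr E) p" "\<And>u. u \<in> carr E \<Longrightarrow> Q (p u) = p u"
      "\<And>u. u \<in> carr E \<Longrightarrow> norm (p u) \<le> sp_norm E u" "\<And>x. p (A x) = Q x"
    using ap by (auto simp: approx_pair_def)
  note A_simps = linear_add[OF A(1)] linear_diff[OF A(1)] linear_scale[OF A(1)] A(3)
  note Q_simps = linear_add[OF Q(1)] linear_diff[OF Q(1)] linear_scale[OF Q(1)] Q(2) QQ'
  note Q'_simps = linear_add[OF Q'(1)] linear_diff[OF Q'(1)] linear_scale[OF Q'(1)] Q'(2)
  have nE: "norm_on (carr E) (sp_norm E)"
    using E by (simp add: rational_space_def)
  have carrE: "carr E = coord_space n"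
    by (simp add: carr_def n_def)
  have subE: "subspace (carr E)"
    by (simp add: carrE subspace_coord_space)
  note in_E = subspace_add[OF subE] subspace_diff[OF subE] subspace_scale[OF subE] A(2)
    trunc_in_coord_space[of n, folded carrE]
  have p_add: "p (u + v) = p u + p v" if "u \<in> carr E" "v \<in> carr E" for u v
    using p(1) that by (auto simp: linear_map_on_def)
  have p_scale: "p (a *\<^sub>R u) = a *\<^sub>R p u" if "u \<in> carr E" for u a
    using p(1) that by (auto simp: linear_map_on_def)
  have p_diff: "p (u - v) = p u - p v" if "u \<in> carr E" "v \<in> carr E" for u v
    using p_add[of "u - v" v] that in_E by simp
  obtain d :: nat and \<beta> :: "seq_vec \<Rightarrow> 'x" and \<kappa> :: "'x \<Rightarrow> seq_vec" where lin\<beta>: "linear \<beta>" and lin\<kappa>: "linear \<kappa>"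
    and Q'\<beta>: "\<And>w. Q' (\<beta> w) = \<beta> w" and \<kappa>Q': "\<And>x. \<kappa> (Q' x) = \<kappa> x"
    and \<beta>\<kappa>: "\<And>x. \<beta> (\<kappa> x) = Q' x"
    and \<kappa>_in: "\<And>x. \<kappa> x \<in> coord_space (n + d)" and trunc_\<kappa>: "\<And>x. trunc n (\<kappa> x) = 0"
    and \<beta>0: "\<And>w. w \<in> coord_space n \<Longrightarrow> \<beta> w = 0"
    and \<kappa>\<beta>: "\<And>w. w \<in> coord_space (n + d) \<Longrightarrow> \<kappa> (\<beta> w) = w - trunc n w"
    by (rule finite_rank_coordinates[OF Q'(1-3), where n = n]) (rule that; assumption)
  note \<beta>_simps = linear_add[OF lin\<beta>] linear_diff[OF lin\<beta>] linear_scale[OF lin\<beta>]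
  let ?V = "coord_space (n + d)"
  have V: "subspace ?V"
    by (rule subspace_coord_space)
  have EV: "carr E \<subseteq> ?V"
    by (simp add: carrE coord_space_mono)
  define u where "u w = trunc n w - c *\<^sub>R A (\<beta> w)" for w
  have u_in: "u w \<in> carr E" for w
    by (simp add: u_def in_E)
  have u_add: "u (w + w') = u w + u w'" and u_scale: "u (a *\<^sub>R w) = a *\<^sub>R u w" for w w' a
    by (simp_all add: u_def trunc_add trunc_scaleR A_simps \<beta>_simps algebra_simps)
  \<comment> \<open>\<open>u w\<close> and \<open>\<beta> w\<close> are the components of \<open>w\<close> in the amalgam, in which \<open>A x\<close> and \<open>Q x\<close> are
    at distance at most \<open>\<delta> * norm (Q x)\<close>. The factor \<open>c\<close> makes truncation a contraction although
    the norm of \<open>A\<close> may exceed 1.\<close>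
  define g where "g w x = sp_norm E (u w + A x) + norm (\<beta> w - Q x) + \<delta> * norm (Q x)" for w x
  define N where "N w = (INF x. g w x)" for w
  have gnn: "0 \<le> g w x" for w x
    unfolding g_def using \<delta> norm_on_nonneg[OF nE] u_in in_E by simp
  have gsc: "g (a *\<^sub>R w) (a *\<^sub>R x) = \<bar>a\<bar> * g w x" for a w x
  proof -
    have "u (a *\<^sub>R w) + A (a *\<^sub>R x) = a *\<^sub>R (u w + A x)"
      by (simp add: u_scale A_simps scaleR_add_right)
    moreover have "\<beta> (a *\<^sub>R w) - Q (a *\<^sub>R x) = a *\<^sub>R (\<beta> w - Q x)"
      by (simp add: \<beta>_simps Q_simps scaleR_diff_right)
    moreover have "sp_norm E (a *\<^sub>R (u w + A x)) = \<bar>a\<bar> * sp_norm E (u w + A x)"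
      using u_in in_E by (intro norm_on_scaleR[OF nE]) auto
    ultimately show ?thesis
      by (simp only: g_def linear_scale[OF Q(1)] norm_scaleR distrib_left mult.left_commute)
  qed
  have gtri: "g (w + w') (x + x') \<le> g w x + g w' x'" for w w' x x'
  proof -
    have "u (w + w') + A (x + x') = (u w + A x) + (u w' + A x')"
      by (simp add: u_add A_simps)
    then have "sp_norm E (u (w + w') + A (x + x')) \<le> sp_norm E (u w + A x) + sp_norm E (u w' + A x')"
      using norm_on_triangle[OF nE, of "u w + A x" "u w' + A x'"] u_in in_E by simp
    moreover have "\<beta> (w + w') - Q (x + x') = (\<beta> w - Q x) + (\<beta> w' - Q x')"
      by (simp add: \<beta>_simps Q_simps)
    then have "norm (\<beta> (w + w') - Q (x + x')) \<le> norm (\<beta> w - Q x) + norm (\<beta> w' - Q x')"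
      by (simp only: norm_triangle_ineq)
    moreover have "\<delta> * norm (Q (x + x')) \<le> \<delta> * (norm (Q x) + norm (Q x'))"
      using \<delta> by (simp only: linear_add[OF Q(1)] norm_triangle_ineq mult_left_mono less_imp_le)
    ultimately show ?thesis
      unfolding g_def by (simp add: distrib_left)
  qed
  have N_le: "N w \<le> g w x" and N_scale: "N (a *\<^sub>R w) = \<bar>a\<bar> * N w"
    and N_tri: "N (w + w') \<le> N w + N w'" if "w \<in> ?V" "w' \<in> ?V" for w w' x a
    using infimum_seminorm[of ?V g, OF V gnn gsc gtri] that unfolding N_def by blast+
  have N_ge: "a \<le> N w" if "\<And>x. a \<le> g w x" for a w
    unfolding N_def using that by (intro cINF_greatest) auto
  \<comment> \<open>Because A factors through Q, its norm bound involves only the component Q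
    x.\<close>
  have AQ_le: "sp_norm E (A x) \<le> (1 + \<delta>) * norm (Q x)" for x
    using A(4)[of "Q x"] by (simp add: A(3))
  have trunc_le: "sp_norm E (trunc n w) \<le> N w" for w
  proof (rule N_ge)
    fix x
    have in1: "c *\<^sub>R A (\<beta> w - Q x) \<in> carr E" "(c - 1) *\<^sub>R A x \<in> carr E" "u w + A x \<in> carr E"
      using in_E u_in by auto
    \<comment> \<open>The three summands are controlled by the three terms of \<open>g w x\<close>:
      the second because c (1 + \<delta>) = 1, the third because (1 - c) (1 + \<delta>) =
      \<delta>.\<close>
    have "trunc n w = (u w + A x) + (c *\<^sub>R A (\<beta> w - Q x) + (c - 1) *\<^sub>R A x)"
      by (simp add: u_def A_simps algebra_simps)
    then have "sp_norm E (trunc n w) \<le> sp_norm E (u w + A x)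
        + (sp_norm E (c *\<^sub>R A (\<beta> w - Q x)) + sp_norm E ((c - 1) *\<^sub>R A x))"
      using norm_on_triangle[OF nE in1(3) subspace_add[OF subE in1(1,2)]]
        norm_on_triangle[OF nE in1(1,2)] by simp
    also have "sp_norm E (c *\<^sub>R A (\<beta> w - Q x)) \<le> norm (\<beta> w - Q x)"
    proof -
      have "sp_norm E (c *\<^sub>R A (\<beta> w - Q x)) \<le> c * ((1 + \<delta>) * norm (\<beta> w - Q x))"
        using norm_on_scaleR[OF nE A(2)] c A(4) by (simp add: mult_left_mono)
      then show ?thesis
        using c(3) by (simp add: mult.assoc[symmetric])
    qed
    also have "sp_norm E ((c - 1) *\<^sub>R A x) \<le> \<delta> * norm (Q x)"
    proof -
      have "sp_norm E ((c - 1) *\<^sub>R A x) \<le> (1 - c) * ((1 + \<delta>) * norm (Q x))"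
        using norm_on_scaleR[OF nE A(2), of "c - 1" x] c AQ_le[of x] by (simp add: mult_left_mono)
      also have "\<dots> = ((1 + \<delta>) - c * (1 + \<delta>)) * norm (Q x)"
        by (simp add: algebra_simps)
      finally show ?thesis
        using c(3) by simp
    qed
    finally show "sp_norm E (trunc n w) \<le> g w x"
      by (simp add: g_def)
  qed
  \<comment> \<open>This is \<open>p (u w) + \<beta> w\<close>, rewritten with
    \<open>p (A x) = Q x\<close>. A shift by A x in the first component and -Q x in the second
    leaves it unchanged, hence it is bounded by every \<open>g w x\<close>.\<close>
  define s where "s w = p (trunc n w) + (\<beta> w - c *\<^sub>R Q (\<beta> w))" for w
  have s_le: "norm (s w) \<le> N w" for w
  proof (rule N_ge)
    fix x
    have "p (u w + A x) = p (trunc n w) - c *\<^sub>R Q (\<beta> w) + Q x"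
      using in_E u_in by (simp add: u_def p_add p_diff p_scale p(4))
    then have "s w = p (u w + A x) + (\<beta> w - Q x)"
      by (simp add: s_def)
    then have "norm (s w) \<le> norm (p (u w + A x)) + norm (\<beta> w - Q x)"
      by (simp add: norm_triangle_ineq)
    also have "\<dots> \<le> g w x"
      using p(3)[of "u w + A x"] in_E u_in \<delta> by (simp add: g_def add_increasing2)
    finally show "norm (s w) \<le> g w x" .
  qed
  have N_zero: "w = 0" if w: "w \<in> ?V" "N w = 0" for w
  proof -
    \<comment> \<open>The two contractions \<open>trunc\<close> and \<open>s\<close> together
      separate points: once both vanish, \<open>\<beta> w\<close> equals c times its image under Q,
      and applying Q with c < 1 forces it to be 0.\<close>
    have t0: "trunc n w = 0"
      using trunc_le[of w] w norm_on_nonneg[OF nE] norm_on_eq_0[OF nE] in_E by (metis order_antisym)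
    have "p 0 = 0"
      using p_scale[of 0 0] subspace_0[OF subE] by simp
    then have b: "\<beta> w = c *\<^sub>R Q (\<beta> w)"
      using s_le[of w] w t0 by (simp add: s_def)
    then have "Q (\<beta> w) = c *\<^sub>R Q (\<beta> w)"
      by (metis Q(2) linear_scale[OF Q(1)])
    then have "(1 - c) *\<^sub>R Q (\<beta> w) = 0"
      by (simp add: algebra_simps)
    then have "\<beta> w = 0"
      using b c by simp
    then show ?thesis
      using \<kappa>\<beta>[OF w(1)] t0 linear_0[OF lin\<kappa>] by simp
  qed
  have nN: "norm_on ?V N"
  proof -
    have "N 0 = 0"
      using N_scale[of 0 0 0] subspace_0[OF V] by simp
    then show ?thesis
      unfolding norm_on_def using N_ge[OF gnn] N_zero N_scale N_tri by blast
  qed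
  have NE: "N w = sp_norm E w" if w: "w \<in> carr E" for w
  proof (rule order_antisym)
    have wt: "trunc n w = w" "\<beta> w = 0"
      using w \<beta>0 by (auto simp: carrE trunc_id)
    show "sp_norm E w \<le> N w"
      using trunc_le[of w] wt by simp
    \<comment> \<open>The choice x = 0 in the infimum suffices.\<close>
    show "N w \<le> sp_norm E w"
      using N_le[of w w 0] w EV wt by (auto simp: g_def u_def linear_0[OF A(1)] linear_0[OF Q(1)])
  qed
  \<comment> \<open>With this r the rational norm exceeds N by a factor of at most 1 + \<delta>',
    which is the tolerance allowed for the new embedding.\<close>
  define r where "r = 1 / (1 + \<delta>')"
  have r: "0 < r" "r < 1"
    using \<delta> by (simp_all add: r_def)
  obtain Y where Y: "rational_space Y" "sp_dim Y = n + d" "is_arrow E Y (id, trunc (sp_dim E))"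
    "\<And>x. x \<in> ?V \<Longrightarrow> N x \<le> sp_norm Y x" "\<And>x. x \<in> ?V \<Longrightarrow> r * sp_norm Y x \<le> N x"
  proof (rule rational_extension_approximation[OF E _ nN NE _ r])
    show "N (trunc (sp_dim E) x) \<le> N x" for x
      using trunc_le[of x] NE[of "trunc n x"] in_E by (simp add: n_def)
  qed (auto simp: n_def)
  have carrY: "carr Y = ?V"
    by (simp add: carr_def Y(2))
  have Y_le: "sp_norm Y w \<le> (1 + \<delta>') * a" if "w \<in> ?V" "N w \<le> a" for w a
    using order_trans[OF Y(5)[OF that(1)] that(2)] \<delta> by (simp add: r_def field_simps)
  \<comment> \<open>The vector whose components are u = 0 and \<beta> = Q' x; the term c A x
    compensates for the skew coordinates.\<close>
  define A' where "A' x = \<kappa> x + c *\<^sub>R A x" for x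
  have A'_in: "A' x \<in> ?V" for x
    unfolding A'_def using in_E EV \<kappa>_in by (intro subspace_add[OF V]) auto
  have AQ': "A (Q' x) = A x" for x
    by (metis A(3) QQ'(1))
  have \<beta>A: "\<beta> (A x) = 0" for x
    using \<beta>0 A(2) by (simp add: carrE)
  have \<beta>A': "\<beta> (A' x) = Q' x" for x
    by (simp add: A'_def \<beta>_simps \<beta>\<kappa> \<beta>A)
  have truncA: "trunc n (A x) = A x" for x
    using A(2) by (simp add: carrE trunc_id)
  have truncA': "trunc n (A' x) = c *\<^sub>R A x" for x
    by (simp add: A'_def trunc_add trunc_scaleR trunc_\<kappa> truncA)
  have "approx_pair Y Q' \<delta>' A' s"
    unfolding approx_pair_def
  proof (intro conjI allI ballI)
    show "linear A'"
      by (rule linearI)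
        (simp_all add: A'_def A_simps linear_add[OF lin\<kappa>] linear_scale[OF lin\<kappa>] algebra_simps)
    show "range A' \<subseteq> carr Y"
      using A'_in by (auto simp: carrY)
    show "A' (Q' x) = A' x" for x
      by (simp add: A'_def \<kappa>Q' AQ')
    show "sp_norm Y (A' x) \<le> (1 + \<delta>') * norm x" for x
    proof (rule Y_le[OF A'_in])
      have "u (A' x) = 0"
        by (simp add: u_def truncA' \<beta>A' AQ')
      then have "g (A' x) 0 = norm (Q' x)"
        using norm_on_zero[OF nE subE] by (simp add: g_def \<beta>A' linear_0[OF A(1)] linear_0[OF Q(1)])
      then show "N (A' x) \<le> norm x"
        using N_le[OF A'_in A'_in, of x 0] Q'(4)[of x] by simp
    qed
    show "linear_map_on (carr Y) s"
      unfolding linear_map_on_def s_def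
      by (simp add: trunc_add trunc_scaleR p_add p_scale in_E \<beta>_simps linear_add[OF Q(1)]
          linear_scale[OF Q(1)] scaleR_add_right scaleR_diff_right mult.commute)
    show "Q' (s w) = s w" for w
    proof -
      have "Q' (p (trunc n w)) = p (trunc n w)"
        by (metis QQ'(2) p(2) in_E(5))
      then show ?thesis
        by (simp add: s_def Q'_simps Q'\<beta> QQ')
    qed
    show "norm (s w) \<le> sp_norm Y w" if "w \<in> carr Y" for w
      using s_le[of w] Y(4)[of w] that by (simp add: carrY)
    show "s (A' x) = Q' x" for x
      using in_E by (simp add: s_def truncA' \<beta>A' p_scale p(4) QQ')
  qed
  moreover have "s (fst (id, trunc (sp_dim E)) w) = p w" if "w \<in> carr E" for w
    using that \<beta>0 by (simp add: s_def carrE trunc_id linear_0[OF Q(1)])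
  moreover have "sp_norm Y (A' (Q x) - fst (id, trunc (sp_dim E)) (A x)) \<le> \<delta> * (1 + \<delta>') * norm x" for x
  proof -
    let ?w = "A' (Q x) - A x"
    have w: "?w \<in> ?V"
      using A'_in A(2) EV by (intro subspace_diff[OF V]) auto
    \<comment> \<open>The components of this difference are -A x and Q x, so taking the same x in
      the infimum cancels both and leaves the gluing cost \<delta> times the norm of Q x.\<close>
    have "u ?w = - A x"
      by (simp add: u_def trunc_minus truncA' truncA \<beta>_simps \<beta>A' \<beta>A A_simps QQ')
    moreover have "\<beta> ?w = Q x"
      by (simp add: \<beta>_simps \<beta>A' \<beta>A QQ')
    ultimately have "g ?w x = \<delta> * norm (Q x)"
      using norm_on_zero[OF nE subE] by (simp add: g_def)
    also have "\<dots> \<le> \<delta> * norm x"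
      using \<delta> Q(3)[of x] by simp
    finally have "N ?w \<le> \<delta> * norm x"
      using N_le[OF w w, of x] by linarith
    then show ?thesis
      using Y_le[OF w, of "\<delta> * norm x"] by (simp add: mult.assoc mult.left_commute)
  qed
  ultimately show ?thesis
    by (rule that[OF Y(1) Y(3)])
qed

subsection \<open>Passage to the completion\<close>

lemma arrowD:
  assumes "is_arrow E F f"
  shows arrow_fst_in: "x \<in> carr E \<Longrightarrow> fst f x \<in> carr F"
    and arrow_snd_in: "y \<in> carr F \<Longrightarrow> snd f y \<in> carr E"
    and arrow_fst_norm: "x \<in> carr E \<Longrightarrow> sp_norm F (fst f x) = sp_norm E x"
    and arrow_snd_norm: "y \<in> carr F \<Longrightarrow> sp_norm E (snd f y) \<le> sp_norm F y"
    and arrow_snd_fst: "x \<in> carr E \<Longrightarrow> snd f (fst f x) = x"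
    and arrow_fst_linear: "linear_map_on (carr E) (fst f)"
    and arrow_snd_linear: "linear_map_on (carr F) (snd f)"
  using assms by (auto simp: is_arrow_def rational_1_bounded_def)

lemma subspace_carr: "subspace (carr E)"
  by (simp add: carr_def subspace_coord_space)

lemma linear_map_on_diff:
  assumes "linear_map_on V T" "subspace V" "x \<in> V" "y \<in> V"
  shows "T (x - y) = T x - T y"
  using assms subspace_diff[OF assms(2-4)] unfolding linear_map_on_def
  by (metis add_diff_cancel_right' diff_add_cancel)

lemma approx_pair_arrow:
  assumes ap: "approx_pair Y Q \<delta> A p" and g: "is_arrow Y Z g"
  shows "approx_pair Z Q \<delta> (fst g \<circ> A) (p \<circ> snd g)"
proof -
  have A: "linear A" "\<And>x. A x \<in> carr Y" "\<And>x. A (Q x) = A x"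
      "\<And>x. sp_norm Y (A x) \<le> (1 + \<delta>) * norm x"
    and p: "linear_map_on (carr Y) p" "\<And>u. u \<in> carr Y \<Longrightarrow> Q (p u) = p u"
      "\<And>u. u \<in> carr Y \<Longrightarrow> norm (p u) \<le> sp_norm Y u" "\<And>x. p (A x) = Q x"
    using ap by (auto simp: approx_pair_def)
  have "linear (fst g \<circ> A)"
    using arrow_fst_linear[OF g] A(2)
    by (intro linearI) (simp_all add: linear_map_on_def linear_add[OF A(1)] linear_scale[OF A(1)])
  moreover have "linear_map_on (carr Z) (p \<circ> snd g)"
    using arrow_snd_linear[OF g] p(1) arrow_snd_in[OF g] by (simp add: linear_map_on_def)
  moreover have "norm (p (snd g u)) \<le> sp_norm Z u" if "u \<in> carr Z" for u
    using p(3)[OF arrow_snd_in[OF g that]] arrow_snd_norm[OF g that] by linarith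
  ultimately show ?thesis
    using A p(2,4) arrow_fst_in[OF g] arrow_snd_in[OF g] arrow_fst_norm[OF g] arrow_snd_fst[OF g]
    by (auto simp: approx_pair_def)
qed

text \<open>A linear contraction is uniformly continuous, so it extends continuously from a dense
  subspace into a complete space; linearity and the norm bound pass to limits of sequences.\<close>

lemma contraction_extension:
  fixes T :: "'a::real_normed_vector \<Rightarrow> 'b::banach"
  assumes S: "subspace S" "closure S = UNIV" and T: "linear_map_on S T"
    and le: "\<And>y. y \<in> S \<Longrightarrow> norm (T y) \<le> norm y"
  obtains R where "bounded_linear R" "\<And>y. norm (R y) \<le> norm y" "\<And>y. y \<in> S \<Longrightarrow> R y = T y"
proof -
  have lip: "dist (T x) (T y) \<le> dist x y" if "x \<in> S" "y \<in> S" for x y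
    using le[OF subspace_diff[OF S(1) that]] linear_map_on_diff[OF T S(1) that] by (simp add: dist_norm)
  have "uniformly_continuous_on S T"
    unfolding uniformly_continuous_on_def using lip by (meson le_less_trans)
  then obtain R where R: "uniformly_continuous_on (closure S) R" "\<And>y. y \<in> S \<Longrightarrow> T y = R y"
    using uniformly_continuous_on_extension_on_closure by metis
  have cont: "continuous_on UNIV R"
    using uniformly_continuous_imp_continuous[OF R(1)] S(2) by simp
  have seq: "\<exists>s. (\<forall>n. s n \<in> S) \<and> s \<longlonglongrightarrow> y \<and> (\<lambda>n. T (s n)) \<longlonglongrightarrow> R y" for y
  proof -
    have "y \<in> closure S"
      using S(2) by simp
    then obtain s where s: "\<forall>n. s n \<in> S" "s \<longlonglongrightarrow> y"
      unfolding closure_sequential by blast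
    then have "(\<lambda>n. R (s n)) \<longlonglongrightarrow> R y"
      using continuous_on_tendsto_compose[OF cont s(2)] by simp
    then show ?thesis
      using s R(2) by auto
  qed
  have lim: "(\<lambda>n. T (s n)) \<longlonglongrightarrow> R y" if "\<And>n. s n \<in> S" "s \<longlonglongrightarrow> y" for s y
    using continuous_on_tendsto_compose[OF cont that(2)] that(1) R(2) by simp
  have "R (x + y) = R x + R y" for x y
  proof -
    obtain s t where s: "\<forall>n. s n \<in> S" "s \<longlonglongrightarrow> x" "(\<lambda>n. T (s n)) \<longlonglongrightarrow> R x"
      and t: "\<forall>n. t n \<in> S" "t \<longlonglongrightarrow> y" "(\<lambda>n. T (t n)) \<longlonglongrightarrow> R y"
      using seq by meson
    have "(\<lambda>n. T (s n + t n)) \<longlonglongrightarrow> R (x + y)"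
      using s t by (intro lim tendsto_add subspace_add[OF S(1)]) auto
    moreover have "T (s n + t n) = T (s n) + T (t n)" for n
      using s t T by (simp add: linear_map_on_def)
    ultimately show ?thesis
      using tendsto_add[OF s(3) t(3)] by (simp add: LIMSEQ_unique)
  qed
  moreover have "R (c *\<^sub>R x) = c *\<^sub>R R x" for c x
  proof -
    obtain s where s: "\<forall>n. s n \<in> S" "s \<longlonglongrightarrow> x" "(\<lambda>n. T (s n)) \<longlonglongrightarrow> R x"
      using seq by meson
    have "(\<lambda>n. T (c *\<^sub>R s n)) \<longlonglongrightarrow> R (c *\<^sub>R x)"
      using s by (intro lim tendsto_intros subspace_scale[OF S(1)]) auto
    moreover have "T (c *\<^sub>R s n) = c *\<^sub>R T (s n)" for n
      using s T by (simp add: linear_map_on_def)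
    ultimately show ?thesis
      using tendsto_scaleR[OF tendsto_const s(3)] by (simp add: LIMSEQ_unique)
  qed
  moreover have bound: "norm (R y) \<le> norm y" for y
  proof -
    obtain s where s: "\<forall>n. s n \<in> S" "s \<longlonglongrightarrow> y" "(\<lambda>n. T (s n)) \<longlonglongrightarrow> R y"
      using seq by meson
    show ?thesis
      using s le by (intro LIMSEQ_le[OF tendsto_norm[OF s(3)] tendsto_norm[OF s(2)]]) auto
  qed
  ultimately have "bounded_linear R"
    by (intro bounded_linear_intro[where K = 1]) auto
  then show ?thesis
    using that bound R(2) by simp
qed

text \<open>The maps p n agree along the bonding embeddings and therefore define one contraction on
  the union of the images of the j n, which extends by density.\<close>

lemma contraction_on_completion:
  fixes j :: "nat \<Rightarrow> seq_vec \<Rightarrow> 'p::banach" and p :: "nat \<Rightarrow> seq_vec \<Rightarrow> 'x::banach"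
  assumes seq: "is_sequence U b" and compl: "is_completion_of_union U b j"
    and p: "\<And>n. linear_map_on (carr (U n)) (p n)"
      "\<And>n u. u \<in> carr (U n) \<Longrightarrow> norm (p n u) \<le> sp_norm (U n) u"
      "\<And>n u. u \<in> carr (U n) \<Longrightarrow> p (Suc n) (fst (b n (Suc n)) u) = p n u"
  obtains R where "bounded_linear R" "\<And>y. norm (R y) \<le> norm y"
    "\<And>n u. u \<in> carr (U n) \<Longrightarrow> R (j n u) = p n u"
proof -
  have arr: "is_arrow (U n) (U m) (b n m)" if "n \<le> m" for n m
    using seq that by (simp add: is_sequence_def)
  have b_id: "fst (b n n) u = u" if "u \<in> carr (U n)" for n u
    using seq that by (simp add: is_sequence_def arrow_eq_def arrow_id_def)
  have b_comp: "fst (b m k) (fst (b n m) u) = fst (b n k) u" if "n \<le> m" "m \<le> k" "u \<in> carr (U n)" for n m k u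
    using seq that unfolding is_sequence_def arrow_eq_def arrow_comp_def by (metis comp_apply fst_conv)
  have b_in: "fst (b n m) u \<in> carr (U m)" if "n \<le> m" "u \<in> carr (U n)" for n m u
    using arrow_fst_in[OF arr] that by blast
  have j: "\<And>n. linear_map_on (carr (U n)) (j n)"
      "\<And>n u. u \<in> carr (U n) \<Longrightarrow> norm (j n u) = sp_norm (U n) u"
      "\<And>n m u. n \<le> m \<Longrightarrow> u \<in> carr (U n) \<Longrightarrow> j m (fst (b n m) u) = j n u"
      "closure (\<Union>n. j n ` carr (U n)) = UNIV"
    using compl by (auto simp: is_completion_of_union_def)
  have p_comp: "p m (fst (b n m) u) = p n u" if "n \<le> m" "u \<in> carr (U n)" for n m u
    using that(1)
  proof (induction m rule: dec_induct)
    case base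
    then show ?case
      using b_id that(2) by simp
  next
    case (step m)
    then show ?case
      using b_comp[of n m "Suc m" u] p(3)[OF b_in[of n m u]] that(2) by simp
  qed
  define S where "S = (\<Union>n. j n ` carr (U n))"
  have common: "\<exists>n. \<exists>u\<in>carr (U n). \<exists>v\<in>carr (U n). y = j n u \<and> z = j n v" if yz: "y \<in> S" "z \<in> S" for y z
  proof -
    obtain n u where "u \<in> carr (U n)" "y = j n u"
      using yz(1) by (auto simp: S_def)
    moreover obtain m v where "v \<in> carr (U m)" "z = j m v"
      using yz(2) by (auto simp: S_def)
    ultimately show ?thesis
      using b_in[of n "max n m" u] b_in[of m "max n m" v] j(3)[of n "max n m" u] j(3)[of m "max n m" v]
      by (metis max.cobounded1 max.cobounded2)
  qed
  have j_add: "j n (u + v) = j n u + j n v" if "u \<in> carr (U n)" "v \<in> carr (U n)" for n u v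
    using j(1) that by (simp add: linear_map_on_def)
  have j_scale: "j n (c *\<^sub>R u) = c *\<^sub>R j n u" if "u \<in> carr (U n)" for n u c
    using j(1) that by (simp add: linear_map_on_def)
  have subS: "subspace S"
    unfolding subspace_def
  proof (intro conjI ballI allI)
    show "0 \<in> S"
      using j_scale[OF subspace_0[OF subspace_carr], of 0 0] subspace_0[OF subspace_carr[of "U 0"]]
      by (auto simp: S_def intro!: image_eqI[of _ _ 0])
    show "y + z \<in> S" if yz: "y \<in> S" "z \<in> S" for y z
    proof -
      obtain n u v where u: "u \<in> carr (U n)" "v \<in> carr (U n)" and "y = j n u" "z = j n v"
        using common[OF yz] by blast
      then have "y + z = j n (u + v)" "u + v \<in> carr (U n)"
        using j_add[OF u] subspace_add[OF subspace_carr u] by auto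
      then show ?thesis
        by (auto simp: S_def)
    qed
    show "c *\<^sub>R y \<in> S" if y: "y \<in> S" for c y
    proof -
      obtain n u where u: "u \<in> carr (U n)" "y = j n u"
        using y by (auto simp: S_def)
      then have "c *\<^sub>R y = j n (c *\<^sub>R u)" "c *\<^sub>R u \<in> carr (U n)"
        using j_scale[OF u(1)] subspace_scale[OF subspace_carr u(1)] by auto
      then show ?thesis
        by (auto simp: S_def)
    qed
  qed
  \<comment> \<open>A point of the union has representatives at many stages. Two of them can be
    pushed to a common stage, where j is injective because it is isometric, so compatibility of the
    p n makes the choice immaterial.\<close>
  define T where "T y = (SOME v. \<exists>n. \<exists>u\<in>carr (U n). y = j n u \<and> v = p n u)" for y
  have unique: "p n u = p m v" if "u \<in> carr (U n)" "v \<in> carr (U m)" "j n u = j m v" for n m u v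
  proof -
    let ?k = "max n m"
    let ?u = "fst (b n ?k) u" and ?v = "fst (b m ?k) v"
    have in_k: "?u \<in> carr (U ?k)" "?v \<in> carr (U ?k)"
      using b_in that by auto
    have "j ?k (?u - ?v) = 0"
      using linear_map_on_diff[OF j(1) subspace_carr in_k] j(3) that by simp
    then have "sp_norm (U ?k) (?u - ?v) = 0"
      using j(2)[OF subspace_diff[OF subspace_carr in_k]] by simp
    moreover have "norm_on (carr (U ?k)) (sp_norm (U ?k))"
      using seq by (simp add: is_sequence_def rational_space_def)
    ultimately have "?u = ?v"
      using norm_on_eq_0 subspace_diff[OF subspace_carr in_k] by force
    then show ?thesis
      using p_comp[of n ?k u] p_comp[of m ?k v] that by simp
  qed
  have T_j: "T (j n u) = p n u" if "u \<in> carr (U n)" for n u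
  proof -
    have "\<exists>m. \<exists>v\<in>carr (U m). j n u = j m v \<and> T (j n u) = p m v"
      unfolding T_def by (rule someI[of _ "p n u"]) (use that in blast)
    then show ?thesis
      using unique[OF that] by metis
  qed
  obtain R where R: "bounded_linear R" "\<And>y. norm (R y) \<le> norm y" "\<And>y. y \<in> S \<Longrightarrow> R y = T y"
  proof (rule contraction_extension[OF subS])
    show "closure S = UNIV"
      using j(4) by (simp add: S_def)
    show "linear_map_on S T"
      unfolding linear_map_on_def
    proof (intro conjI ballI allI)
      fix y z assume "y \<in> S" "z \<in> S"
      then obtain n u v where *: "u \<in> carr (U n)" "v \<in> carr (U n)" "y = j n u" "z = j n v"
        using common by meson
      then show "T (y + z) = T y + T z"
        using T_j[OF subspace_add[OF subspace_carr *(1,2)]] T_j j_add p(1)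
        by (simp add: linear_map_on_def)
    next
      fix c y assume "y \<in> S"
      then obtain n u where *: "u \<in> carr (U n)" "y = j n u"
        by (auto simp: S_def)
      then show "T (c *\<^sub>R y) = c *\<^sub>R T y"
        using T_j[OF subspace_scale[OF subspace_carr *(1), of c]] T_j j_scale p(1)
        by (simp add: linear_map_on_def)
    qed
    show "norm (T y) \<le> norm y" if "y \<in> S" for y
      using that T_j p(2) j(2) by (auto simp: S_def)
  qed (rule that; assumption)
  show ?thesis
  proof (rule that[OF R(1,2)])
    show "R (j n u) = p n u" if "u \<in> carr (U n)" for n u
      using R(3)[of "j n u"] T_j[OF that] that by (auto simp: S_def)
  qed
qed

section \<open>Subsequences of the chain\<close>

lemma is_sequence_subseq:
  assumes "is_sequence U b" "strict_mono k"
  shows "is_sequence (U \<circ> k) (\<lambda>n m. b (k n) (k m))"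
  using assms by (simp add: is_sequence_def strict_mono_less_eq)

text \<open>The indices k n are cofinal, since n is at most k n, so passing to them does not shrink
  the union.\<close>

lemma is_completion_of_union_subseq:
  assumes seq: "is_sequence U b" and compl: "is_completion_of_union U b j" and k: "strict_mono k"
  shows "is_completion_of_union (U \<circ> k) (\<lambda>n m. b (k n) (k m)) (j \<circ> k)"
proof -
  have "(\<Union>n. j n ` carr (U n)) \<subseteq> (\<Union>n. j (k n) ` carr (U (k n)))"
  proof clarify
    fix n u assume u: "u \<in> carr (U n)"
    have le: "n \<le> k n"
      using k by (rule strict_mono_imp_increasing)
    then have "is_arrow (U n) (U (k n)) (b n (k n))"
      using seq by (simp add: is_sequence_def)
    then have "fst (b n (k n)) u \<in> carr (U (k n))"
      using arrow_fst_in u by blast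
    moreover have "j n u = j (k n) (fst (b n (k n)) u)"
      using compl le u by (simp add: is_completion_of_union_def)
    ultimately show "j n u \<in> (\<Union>n. j (k n) ` carr (U (k n)))"
      by blast
  qed
  from closure_mono[OF this] have "closure (\<Union>n. j (k n) ` carr (U (k n))) = UNIV"
    using compl by (simp add: is_completion_of_union_def top.extremum_unique)
  then show ?thesis
    using compl k by (simp add: is_completion_of_union_def strict_mono_less_eq)
qed

section \<open>Partial sum projections, and the inductive step inside the chain\<close>

lemma FDD_projections:
  assumes D: "monotone_FDD D" and Q_def: "\<And>n x. Q n x = (\<Sum>i<n. D i x)"
  shows "linear (Q n)" "finite_rank (Q n)" "Q m (Q n x) = Q (min m n) x" "norm (Q n x) \<le> norm x"
    "(\<lambda>n. Q n x) \<longlonglongrightarrow> x"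
proof -
  have D: "\<And>n. bounded_linear (D n)" "\<And>n. finite_rank (D n)" "\<And>m n x. m \<noteq> n \<Longrightarrow> D m (D n x) = 0"
      "\<And>x. (\<lambda>n. D n x) sums x" "\<And>n. onorm (Q n) \<le> 1"
    using D by (auto simp: monotone_FDD_def is_FDD_def Q_def[abs_def])
  have blQ: "bounded_linear (Q n)" for n
    unfolding Q_def[abs_def] using D(1) by (rule bounded_linear_sum)
  show "linear (Q n)"
    using blQ by (rule bounded_linear.linear)
  show "norm (Q n x) \<le> norm x"
    using order_trans[OF onorm[OF blQ, of n x] mult_right_mono[OF D(5)[of n] norm_ge_zero]] by simp
  show "(\<lambda>n. Q n x) \<longlonglongrightarrow> x"
    using D(4) by (simp add: Q_def sums_def)
  \<comment> \<open>Apply D n to the expansion of x: by orthogonality only the n-th term of the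
    resulting series can be nonzero.\<close>
  have DD: "D n (D n x) = D n x" for n x
  proof -
    have 1: "(\<lambda>i. D n (D i x)) sums D n x"
      by (rule bounded_linear.sums[OF D(1) D(4)])
    have 2: "(\<lambda>i. D n (D i x)) sums (\<Sum>i\<in>{n}. D n (D i x))"
      using D(3) by (intro sums_finite) auto
    show ?thesis
      using sums_unique2[OF 1 2] by simp
  qed
  show "Q m (Q n x) = Q (min m n) x"
  proof -
    have "D i (Q n x) = (if i < n then D i x else 0)" for i
    proof -
      have "D i (Q n x) = (\<Sum>l<n. D i (D l x))"
        unfolding Q_def by (rule linear_sum[OF bounded_linear.linear[OF D(1)]])
      also have "\<dots> = (\<Sum>l<n. if l = i then D i x else 0)"
        using D(3) DD by (intro sum.cong) auto
      finally show ?thesis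
        by simp
    qed
    then have "Q m (Q n x) = (\<Sum>i<m. if i < n then D i x else 0)"
      by (simp add: Q_def)
    also have "\<dots> = (\<Sum>i\<in>{..<m} \<inter> {i. i < n}. D i x)"
      by (simp add: sum.If_cases)
    also have "{..<m} \<inter> {i. i < n} = {..<min m n}"
      by auto
    finally show ?thesis
      by (simp add: Q_def)
  qed
  obtain B where B: "\<And>i. finite (B i)" "\<And>i. range (D i) \<subseteq> span (B i)"
    using D(2) unfolding finite_rank_def by metis
  have "Q n x \<in> span (\<Union>i<n. B i)" for x
    unfolding Q_def
  proof (rule span_sum)
    fix i assume "i \<in> {..<n}"
    then have "span (B i) \<subseteq> span (\<Union>i<n. B i)"
      by (intro span_mono) auto
    then show "D i x \<in> span (\<Union>i<n. B i)"
      using B(2) by blast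
  qed
  then show "finite_rank (Q n)"
    unfolding finite_rank_def using B(1) by (intro exI[of _ "\<Union>i<n. B i"]) auto
qed

text \<open>The amalgam Y is absorbed into the chain by an arrow g. Since g after f is the bonding
  arrow, the exact extension and the estimate relative to f become statements relative to
  \<open>b k m\<close>.\<close>

lemma Fraisse_sequence_step:
  fixes Q Q' :: "'x::real_normed_vector \<Rightarrow> 'x"
  assumes F: "Fraisse_sequence U b" and ap: "approx_pair (U k) Q \<delta> A p" and \<delta>: "\<delta> > 0" "\<delta>' > 0"
    and Q: "linear Q" "\<And>x. Q (Q x) = Q x" "\<And>x. norm (Q x) \<le> norm x"
    and Q': "linear Q'" "\<And>x. Q' (Q' x) = Q' x" "finite_rank Q'" "\<And>x. norm (Q' x) \<le> norm x"
    and QQ': "\<And>x. Q (Q' x) = Q x" "\<And>x. Q' (Q x) = Q x"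
  obtains m A' p' where "m > k" "approx_pair (U m) Q' \<delta>' A' p'"
    "\<And>u. u \<in> carr (U k) \<Longrightarrow> p' (fst (b k m) u) = p u"
    "\<And>x. sp_norm (U m) (A' (Q x) - fst (b k m) (A x)) \<le> \<delta> * (1 + \<delta>') * norm x"
proof -
  have Uk: "rational_space (U k)"
    using F by (simp add: Fraisse_sequence_def is_sequence_def)
  obtain Y f A' p' where Y: "rational_space Y" "is_arrow (U k) Y f" "approx_pair Y Q' \<delta>' A' p'"
    and p': "\<And>u. u \<in> carr (U k) \<Longrightarrow> p' (fst f u) = p u"
    and A': "\<And>x. sp_norm Y (A' (Q x) - fst f (A x)) \<le> \<delta> * (1 + \<delta>') * norm x"
    by (rule approx_pair_step[OF Uk ap \<delta> Q Q' QQ']) (rule that; assumption)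
  obtain m g where m: "m > k" and g: "is_arrow Y (U m) g"
    and gf: "arrow_eq (U k) (U m) (arrow_comp g f) (b k m)"
    using F Y unfolding Fraisse_sequence_def by meson
  have b: "fst (b k m) u = fst g (fst f u)" if "u \<in> carr (U k)" for u
    using gf that by (simp add: arrow_eq_def arrow_comp_def)
  show ?thesis
  proof
    show "m > k"
      by fact
    show "approx_pair (U m) Q' \<delta>' (fst g \<circ> A') (p' \<circ> snd g)"
      using approx_pair_arrow[OF Y(3) g] .
    \<comment> \<open>The projection of g undoes its embedding, which reduces the claim to the one
      for f.\<close>
    show "(p' \<circ> snd g) (fst (b k m) u) = p u" if "u \<in> carr (U k)" for u
      using b that p' arrow_snd_fst[OF g arrow_fst_in[OF Y(2)]] by simp
    show "sp_norm (U m) ((fst g \<circ> A') (Q x) - fst (b k m) (A x)) \<le> \<delta> * (1 + \<delta>') * norm x" for x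
    proof -
      have Ax: "A x \<in> carr (U k)" and "A' (Q x) \<in> carr Y"
        using ap Y(3) by (auto simp: approx_pair_def)
      then have in_Y: "A' (Q x) \<in> carr Y" "fst f (A x) \<in> carr Y"
        using arrow_fst_in[OF Y(2)] by auto
      then have "(fst g \<circ> A') (Q x) - fst (b k m) (A x) = fst g (A' (Q x) - fst f (A x))"
        using linear_map_on_diff[OF arrow_fst_linear[OF g] subspace_carr in_Y] b[OF Ax] by simp
      then show ?thesis
        using arrow_fst_norm[OF g subspace_diff[OF subspace_carr in_Y]] A' by simp
    qed
  qed
qed

section \<open>The limit embedding and its left inverse\<close>

theorem theorem6p1:
  fixes U :: "nat \<Rightarrow> fin_space"
    and b :: "nat \<Rightarrow> nat \<Rightarrow> arrow"
    and j :: "nat \<Rightarrow> seq_vec \<Rightarrow> 'p::banach"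
    and D :: "nat \<Rightarrow> 'x::banach \<Rightarrow> 'x"
  assumes "Fraisse_sequence U b"
    and "is_completion_of_union U b j"
    and "monotone_FDD D"
  shows "\<exists>e :: 'x \<Rightarrow> 'p. linear e \<and> (\<forall>x. norm (e x) = norm x) \<and> one_complemented (range e)"
proof -
  define Q where "Q n x = (\<Sum>i<n. D i x)" for n x
  note Q = FDD_projections[OF assms(3), of Q, OF Q_def]
  \<comment> \<open>Halving makes the errors telescope: \<open>2 * \<delta> n\<close> equals
    \<open>4 * \<delta> n - 4 * \<delta> (Suc n)\<close>.\<close>
  define \<delta> :: "nat \<Rightarrow> real" where "\<delta> n = (1 / 2) ^ n" for n
  have \<delta>: "0 < \<delta> n" "\<delta> n \<le> 1" "\<delta> (Suc n) = \<delta> n / 2" for n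
    by (simp_all add: \<delta>_def power_le_one)
  have \<delta>0: "\<delta> \<longlonglongrightarrow> 0"
    unfolding \<delta>_def by (rule LIMSEQ_power_zero) simp
  have seq: "is_sequence U b"
    using assms(1) by (simp add: Fraisse_sequence_def)
  \<comment> \<open>The state of the recursion is a stage k of the chain with the two maps A and p.
    The invariant ?P depends on n, and ?R relates consecutive states.\<close>
  let ?P = "\<lambda>n (k, A, p). approx_pair (U k) (Q n) (\<delta> n) A p"
  let ?R = "\<lambda>n (k, A, p) (k', A', p'). k < k' \<and>
      (\<forall>u\<in>carr (U k). p' (fst (b k k') u) = p u) \<and>
      (\<forall>x. sp_norm (U k') (A' (Q n x) - fst (b k k') (A x)) \<le> 2 * \<delta> n * norm x)"
  have "\<exists>F. \<forall>n. ?P n (F n) \<and> ?R n (F n) (F (Suc n))"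
  proof (rule dependent_nat_choice)
    \<comment> \<open>At the start Q 0 is the empty sum, so the zero maps form an admissible
      pair.\<close>
    have "norm_on (carr (U 0)) (sp_norm (U 0))"
      using seq by (simp add: is_sequence_def rational_space_def)
    then have "sp_norm (U 0) 0 = 0" "\<forall>u\<in>carr (U 0). 0 \<le> sp_norm (U 0) u"
      using norm_on_zero[OF _ subspace_carr] norm_on_nonneg by auto
    moreover have "0 \<le> (1 + \<delta> 0) * norm x" for x :: 'x
      using \<delta>(1)[of 0] by simp
    ultimately have "approx_pair (U 0) (Q 0) (\<delta> 0) (\<lambda>x. 0) (\<lambda>u. 0)"
      using subspace_0[OF subspace_carr[of "U 0"]]
      by (simp add: approx_pair_def linear_map_on_def Q_def linear_zero)
    then show "\<exists>x. ?P 0 x"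
      by (intro exI[of _ "(0, (\<lambda>x. 0), (\<lambda>u. 0))"]) simp
  next
    fix x n assume "?P n x"
    then obtain k A p where x: "x = (k, A, p)" and ap: "approx_pair (U k) (Q n) (\<delta> n) A p"
      by (cases x) auto
    obtain m A' p' where m: "m > k" "approx_pair (U m) (Q (Suc n)) (\<delta> (Suc n)) A' p'"
      "\<And>u. u \<in> carr (U k) \<Longrightarrow> p' (fst (b k m) u) = p u"
      "\<And>x. sp_norm (U m) (A' (Q n x) - fst (b k m) (A x)) \<le> \<delta> n * (1 + \<delta> (Suc n)) * norm x"
    proof (rule Fraisse_sequence_step[OF assms(1) ap \<delta>(1) \<delta>(1)[of "Suc n"], of "Q (Suc n)"])
    qed (use Q in auto)
    have "\<delta> n * (1 + \<delta> (Suc n)) * norm x \<le> 2 * \<delta> n * norm x" for x :: 'x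
      using \<delta>(1)[of n] \<delta>(2)[of "Suc n"] by (intro mult_right_mono) auto
    then have "?P (Suc n) (m, A', p') \<and> ?R n x (m, A', p')"
      using m x by (auto intro: order_trans)
    then show "\<exists>y. ?P (Suc n) y \<and> ?R n x y"
      by blast
  qed
  then obtain F where F: "\<forall>n. ?P n (F n) \<and> ?R n (F n) (F (Suc n))" ..
  define k A p where "k n = fst (F n)" and "A n = fst (snd (F n))" and "p n = snd (snd (F n))" for n
  have FkAp: "F n = (k n, A n, p n)" for n
    by (simp add: k_def A_def p_def)
  have ap: "approx_pair (U (k n)) (Q n) (\<delta> n) (A n) (p n)" for n
    using F[rule_format, of n] by (simp add: FkAp)
  have k: "strict_mono k"
    using F by (simp add: FkAp strict_mono_Suc_iff)
  have p_Suc: "p (Suc n) (fst (b (k n) (k (Suc n))) u) = p n u" if "u \<in> carr (U (k n))" for n u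
    using F[rule_format, of n] that by (simp add: FkAp)
  have A_Suc: "sp_norm (U (k (Suc n))) (A (Suc n) (Q n x) - fst (b (k n) (k (Suc n))) (A n x))
      \<le> 2 * \<delta> n * norm x" for n x
    using F[rule_format, of n] by (simp add: FkAp)
  have A: "linear (A n)" "A n x \<in> carr (U (k n))" "A n (Q n x) = A n x" "p n (A n x) = Q n x"
      "sp_norm (U (k n)) (A n x) \<le> (1 + \<delta> n) * norm x" for n x
    using ap[of n] by (auto simp: approx_pair_def)
  have p: "linear_map_on (carr (U (k n))) (p n)"
    "\<And>u. u \<in> carr (U (k n)) \<Longrightarrow> norm (p n u) \<le> sp_norm (U (k n)) u" for n
    using ap[of n] by (auto simp: approx_pair_def)
  \<comment> \<open>The p n live only on the stages k n, so the gluing takes place along that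
    subsequence of the chain.\<close>
  obtain R where R: "bounded_linear R" "\<And>y. norm (R y) \<le> norm y"
    "\<And>n u. u \<in> carr (U (k n)) \<Longrightarrow> R (j (k n) u) = p n u"
  proof (rule contraction_on_completion[OF is_sequence_subseq[OF seq k]
        is_completion_of_union_subseq[OF seq assms(2) k], of p])
  qed (use p p_Suc in auto)
  have j: "linear_map_on (carr (U n)) (j n)"
      "\<And>u. u \<in> carr (U n) \<Longrightarrow> norm (j n u) = sp_norm (U n) u"
      "\<And>m u. n \<le> m \<Longrightarrow> u \<in> carr (U n) \<Longrightarrow> j m (fst (b n m) u) = j n u" for n
    using assms(2) by (auto simp: is_completion_of_union_def)
  define J where "J n x = j (k n) (A n x)" for n x
  have J_lin: "linear (J n)" for n
    using j(1)[of "k n"] A(2)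
    by (intro linearI) (simp_all add: J_def linear_map_on_def linear_add[OF A(1)] linear_scale[OF A(1)])
  have J_le: "norm (J n x) \<le> (1 + \<delta> n) * norm x" for n x
    using j(2) A by (simp add: J_def)
  have J_step: "norm (J (Suc n) (Q n x) - J n x) \<le> 2 * \<delta> n * norm x" for n x
  proof -
    have le: "k n \<le> k (Suc n)"
      using k by (simp add: strict_mono_less_eq)
    have "is_arrow (U (k n)) (U (k (Suc n))) (b (k n) (k (Suc n)))"
      using seq le by (simp add: is_sequence_def)
    then have "fst (b (k n) (k (Suc n))) (A n x) \<in> carr (U (k (Suc n)))"
      using arrow_fst_in A(2) by blast
    note in_U = A(2)[of "Suc n" "Q n x"] this
    have "J (Suc n) (Q n x) - J n x
        = j (k (Suc n)) (A (Suc n) (Q n x) - fst (b (k n) (k (Suc n))) (A n x))"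
      using linear_map_on_diff[OF j(1) subspace_carr in_U] j(3)[OF le A(2)] by (simp add: J_def)
    then show ?thesis
      using j(2)[OF subspace_diff[OF subspace_carr in_U]] A_Suc by simp
  qed
  \<comment> \<open>For n \<ge> m the projection Q n fixes Q m x, so \<open>J_step\<close> can be
    iterated on this one vector without changing it.\<close>
  have J_Q: "norm (J n (Q m x) - J m x) \<le> (4 * \<delta> m - 4 * \<delta> n) * norm x" if "m \<le> n" for m n x
    using that
  proof (induction n rule: dec_induct)
    case base
    show ?case
      by (simp add: J_def A(3))
  next
    case (step n)
    have "Q n (Q m x) = Q m x"
      using Q(3)[of n m x] step.hyps by (simp add: min_def)
    then have "norm (J (Suc n) (Q m x) - J n (Q m x)) \<le> 2 * \<delta> n * norm (Q m x)"
      using J_step[of n "Q m x"] by simp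
    also have "\<dots> \<le> 2 * \<delta> n * norm x"
      using Q(4) \<delta>(1)[of n] by (intro mult_left_mono) auto
    finally have "norm (J (Suc n) (Q m x) - J n (Q m x)) \<le> (4 * \<delta> n - 4 * \<delta> (Suc n)) * norm x"
      by (simp add: \<delta>(3))
    moreover have "norm (J (Suc n) (Q m x) - J m x)
        \<le> norm (J (Suc n) (Q m x) - J n (Q m x)) + norm (J n (Q m x) - J m x)"
      using norm_triangle_ineq[of "J (Suc n) (Q m x) - J n (Q m x)" "J n (Q m x) - J m x"] by simp
    ultimately show ?case
      using step.IH by (simp add: algebra_simps)
  qed
  \<comment> \<open>The bound comes from splitting x into Q m x, where the errors telescope to at
    most \<open>4 * \<delta> m * norm x\<close>, and the rest, where J n has norm at most 2. It does
    not depend on n, so it proves that J n x is Cauchy.\<close>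
  define \<eta> where "\<eta> m x = 2 * norm (x - Q m x) + 4 * \<delta> m * norm x" for m x
  have J_close: "norm (J n x - J m x) \<le> \<eta> m x" if "m \<le> n" for m n x
  proof -
    have "norm (J n (x - Q m x)) \<le> 2 * norm (x - Q m x)"
      by (rule order_trans[OF J_le]) (use \<delta>(2)[of n] in \<open>intro mult_right_mono, auto\<close>)
    moreover have "(4 * \<delta> m - 4 * \<delta> n) * norm x \<le> 4 * \<delta> m * norm x"
      using \<delta>(1)[of n] by (intro mult_right_mono) auto
    moreover have "norm (J n x - J m x) \<le> norm (J n (x - Q m x)) + norm (J n (Q m x) - J m x)"
      using norm_triangle_ineq[of "J n (x - Q m x)" "J n (Q m x) - J m x"]
      by (simp add: linear_diff[OF J_lin])
    ultimately show ?thesis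
      using J_Q[OF that, of x] by (simp add: \<eta>_def)
  qed
  have "(\<lambda>m. \<eta> m x) \<longlonglongrightarrow> 2 * norm (x - x) + 4 * 0 * norm x" for x
    unfolding \<eta>_def by (intro tendsto_intros Q(5) \<delta>0)
  then have \<eta>0: "(\<lambda>m. \<eta> m x) \<longlonglongrightarrow> 0" for x
    by simp
  have "Cauchy (\<lambda>n. J n x)" for x
  proof (rule metric_CauchyI)
    fix \<epsilon> :: real assume "\<epsilon> > 0"
    then obtain m where "\<eta> m x < \<epsilon> / 2"
      using order_tendstoD(2)[OF \<eta>0, of "\<epsilon> / 2" x] by (auto simp: eventually_sequentially)
    then have "dist (J i x) (J l x) < \<epsilon>" if "i \<ge> m" "l \<ge> m" for i l
      using J_close[OF that(1), of x] J_close[OF that(2), of x]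
        dist_triangle2[of "J i x" "J l x" "J m x"] by (simp add: dist_norm)
    then show "\<exists>M. \<forall>i\<ge>M. \<forall>l\<ge>M. dist (J i x) (J l x) < \<epsilon>"
      by blast
  qed
  then have "\<exists>y. (\<lambda>n. J n x) \<longlonglongrightarrow> y" for x
    by (simp add: Cauchy_convergent_iff convergent_def)
  then obtain e where e: "\<And>x. (\<lambda>n. J n x) \<longlonglongrightarrow> e x"
    by metis
  have e_lin: "linear e"
  proof (rule linearI)
    show "e (x + y) = e x + e y" for x y
      using LIMSEQ_unique[OF e tendsto_add[OF e e, of x y, folded linear_add[OF J_lin]]] .
    show "e (c *\<^sub>R x) = c *\<^sub>R e x" for c x
      using LIMSEQ_unique[OF e tendsto_scaleR[OF tendsto_const e, of c x, folded linear_scale[OF J_lin]]] .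
  qed
  have Re: "R (e x) = x" for x
  proof -
    have "(\<lambda>n. R (J n x)) \<longlonglongrightarrow> R (e x)"
      using bounded_linear.tendsto[OF R(1) e] .
    \<comment> \<open>On the image of J n the map R acts as p n, and \<open>p n (A n x)\<close> is Q
      n x, which converges to x.\<close>
    then have "(\<lambda>n. Q n x) \<longlonglongrightarrow> R (e x)"
      using R(3) A(2,4) by (simp add: J_def)
    then show ?thesis
      using LIMSEQ_unique Q(5) by blast
  qed
  have e_norm: "norm (e x) = norm x" for x
  proof (rule order_antisym)
    \<comment> \<open>The lower bound needs no estimate on the A n: the contraction R maps e x back
      to x.\<close>
    show "norm x \<le> norm (e x)"
      using R(2)[of "e x"] by (simp add: Re)
    have "(\<lambda>n. (1 + \<delta> n) * norm x) \<longlonglongrightarrow> (1 + 0) * norm x"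
      by (intro tendsto_intros \<delta>0)
    then show "norm (e x) \<le> norm x"
      using LIMSEQ_le[OF tendsto_norm[OF e]] J_le by fastforce
  qed
  have "bounded_linear e"
    using e_lin e_norm by (intro bounded_linear_intro[where K = 1]) (simp_all add: linear_add linear_scale)
  then have "bounded_linear (e \<circ> R)"
    unfolding comp_def using R(1) by (rule bounded_linear_compose)
  moreover have "onorm (e \<circ> R) \<le> 1"
    using R(2) e_norm by (intro onorm_bound) simp_all
  ultimately have "one_complemented (range e)"
    unfolding one_complemented_def using linear_subspace_image[OF e_lin subspace_UNIV] Re
    by (intro conjI exI[of _ "e \<circ> R"]) auto
  then show ?thesis
    using e_lin e_norm by blast
qed

end
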